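(* Let $\Gamma$ be a countably infinite discrete group. Then every conjugacy class in $\mathrm{Rep}(\Gamma,\mathbb{U})$ is meager. Analogously, every conjugacy class in $\mathrm{Rep}(\Gamma,\mathbb{U}_1)$ is meager.
   Context: $\mathbb{U}$ denotes the Urysohn universal metric space (the completion of the Fraïssé limit of finite metric spaces with rational distances) and $\mathbb{U}_1$ the Urysohn sphere (the completion of the Fraïssé limit of finite metric spaces with rational distances bounded by $1$). For $X\in\{\mathbb{U},\mathbb{U}_1\}$, $\mathrm{Iso}(X)$ is the Polish group of isometries of $X$ with the topology of pointwise convergence, and $\mathrm{Rep}(\Gamma,X)$ is the Polish space of all homomorphisms $\Gamma\to\mathrm{Iso}(X)$, a closed subspace of $\mathrm{Iso}(X)^\Gamma$. $\mathrm{Iso}(X)$ acts on it by conjugation, $(g.\pi)(\gamma)=g\pi(\gamma)g^{-1}$, and conjugacy classes are the orbits of this action. *)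

theory Defs
  imports "HOL-Analysis.Analysis" "HOL-Algebra.Group_Action"
begin

section \<open>Meager sets\<close>

definition nowhere_dense_in :: "'a topology \<Rightarrow> 'a set \<Rightarrow> bool" where
  "nowhere_dense_in T S \<longleftrightarrow> S \<subseteq> topspace T \<and> T interior_of (Abstract_Topology.closure_of T S) = {}"

definition meager_in :: "'a topology \<Rightarrow> 'a set \<Rightarrow> bool" where
  "meager_in T S \<longleftrightarrow>
     (\<exists>\<N>. countable \<N> \<and> (\<forall>N\<in>\<N>. nowhere_dense_in T N) \<and> S = \<Union>\<N>)"


section \<open>The Urysohn space and the Urysohn sphere\<close>

definition isometric_on :: "'a set \<Rightarrow> ('a \<Rightarrow> 'a \<Rightarrow> real) \<Rightarrow> ('b \<Rightarrow> 'b \<Rightarrow> real) \<Rightarrow> ('a \<Rightarrow> 'b) \<Rightarrow> bool" where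
  "isometric_on A d e f \<longleftrightarrow> (\<forall>x\<in>A. \<forall>y\<in>A. e (f x) (f y) = d x y)"

text \<open>The class of finite metric spaces all of whose distances lie in \<open>D\<close>. Only
  \<open>D = \<rat>\<close> and \<open>D = \<rat> \<inter> {0..1}\<close> are used.\<close>

definition finite_metric_space_over :: "real set \<Rightarrow> 'a set \<Rightarrow> ('a \<Rightarrow> 'a \<Rightarrow> real) \<Rightarrow> bool" where
  "finite_metric_space_over D A d \<longleftrightarrow>
     Metric_space A d \<and> finite A \<and> (\<forall>x\<in>A. \<forall>y\<in>A. d x y \<in> D)"

text \<open>The Fraisse limit of that class: a countable metric space whose age (the finite metric
  spaces that embed in it) is the given class, and which is ultrahomogeneous. Every finite metric
  space is isometric to one whose points are natural numbers, so only these are tested in the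
  third clause.\<close>

definition Fraisse_limit_over :: "real set \<Rightarrow> 'a set \<Rightarrow> ('a \<Rightarrow> 'a \<Rightarrow> real) \<Rightarrow> bool" where
  "Fraisse_limit_over D Q d \<longleftrightarrow>
     Metric_space Q d \<and> countable Q \<and>
     (\<forall>A. A \<subseteq> Q \<and> finite A \<longrightarrow> finite_metric_space_over D A d) \<and>
     (\<forall>(A :: nat set) e. finite_metric_space_over D A e \<longrightarrow>
        (\<exists>f. f ` A \<subseteq> Q \<and> isometric_on A e d f)) \<and>
     (\<forall>A f. A \<subseteq> Q \<and> finite A \<and> f ` A \<subseteq> Q \<and> isometric_on A d d f \<longrightarrow>
        (\<exists>g. bij_betw g Q Q \<and> isometric_on Q d d g \<and> (\<forall>x\<in>A. g x = f x)))"

text \<open>\<open>M\<close> is a completion of \<open>Q\<close>, with \<open>Q\<close> identified with its image in \<open>M\<close>.\<close>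

definition is_completion_of :: "'a set \<Rightarrow> ('a \<Rightarrow> 'a \<Rightarrow> real) \<Rightarrow> 'a set \<Rightarrow> bool" where
  "is_completion_of M d Q \<longleftrightarrow>
     Metric_space M d \<and> Metric_space.mcomplete M d \<and>
     Q \<subseteq> M \<and> Abstract_Topology.closure_of (Metric_space.mtopology M d) Q = M"

text \<open>Fraisse limits and completions are determined up to isometry only, so these are
  predicates, true of every realisation of the space in question.\<close>

definition Urysohn_space :: "'a set \<Rightarrow> ('a \<Rightarrow> 'a \<Rightarrow> real) \<Rightarrow> bool" where
  "Urysohn_space M d \<longleftrightarrow> (\<exists>Q. Fraisse_limit_over \<rat> Q d \<and> is_completion_of M d Q)"

definition Urysohn_sphere :: "'a set \<Rightarrow> ('a \<Rightarrow> 'a \<Rightarrow> real) \<Rightarrow> bool" where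
  "Urysohn_sphere M d \<longleftrightarrow> (\<exists>Q. Fraisse_limit_over (\<rat> \<inter> {0..1}) Q d \<and> is_completion_of M d Q)"


section \<open>The isometry group\<close>

definition Iso :: "'a set \<Rightarrow> ('a \<Rightarrow> 'a \<Rightarrow> real) \<Rightarrow> ('a \<Rightarrow> 'a) monoid" where
  "Iso M d = BijGroup M \<lparr>carrier := {f \<in> Bij M. isometric_on M d d f}\<rparr>"

text \<open>Elements of \<^term>\<open>Bij M\<close> are extensional, i.e. points of the product \<open>M\<^sup>M\<close>; the topology of
  pointwise convergence is the one inherited from this product.\<close>

definition Iso_topology :: "'a set \<Rightarrow> ('a \<Rightarrow> 'a \<Rightarrow> real) \<Rightarrow> ('a \<Rightarrow> 'a) topology" where
  "Iso_topology M d =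
     subtopology (product_topology (\<lambda>_. Metric_space.mtopology M d) M) (carrier (Iso M d))"

lemma subgroup_Iso: "subgroup {f \<in> Bij M. isometric_on M d d f} (BijGroup M)"
proof (rule subgroup.intro)
  fix f assume f: "f \<in> {f \<in> Bij M. isometric_on M d d f}"
  then have im: "f ` M = M" by (auto simp: Bij_def bij_betw_def)
  have "d (inv_into M f x) (inv_into M f y) = d x y" if "x \<in> M" "y \<in> M" for x y
  proof -
    have "d (f a) (f b) = d a b" if "a \<in> M" "b \<in> M" for a b
      using f that by (simp add: isometric_on_def)
    moreover have "inv_into M f x \<in> M" "inv_into M f y \<in> M" "f (inv_into M f x) = x" "f (inv_into M f y) = y"
      using that by (simp_all add: im inv_into_into f_inv_into_f)
    ultimately show ?thesis by metis
  qed
  then show "inv\<^bsub>BijGroup M\<^esub> f \<in> {f \<in> Bij M. isometric_on M d d f}"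
    using f restrict_inv_into_Bij[of f M] by (simp add: inv_BijGroup isometric_on_def)
next
  fix f g assume "f \<in> {f \<in> Bij M. isometric_on M d d f}" "g \<in> {f \<in> Bij M. isometric_on M d d f}"
  moreover from this have "g x \<in> M" if "x \<in> M" for x
    using Bij_imp_funcset that by blast
  ultimately show "f \<otimes>\<^bsub>BijGroup M\<^esub> g \<in> {f \<in> Bij M. isometric_on M d d f}"
    by (simp add: BijGroup_def compose_Bij isometric_on_def compose_eq)
qed (auto simp: BijGroup_def id_Bij isometric_on_def)

lemma group_Iso: "group (Iso M d)"
  unfolding Iso_def by (rule group.subgroup_imp_group[OF group_BijGroup subgroup_Iso])

lemma topspace_Iso_topology:
  "Metric_space M d \<Longrightarrow> topspace (Iso_topology M d) = carrier (Iso M d)"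
  by (auto simp: Iso_topology_def Iso_def Bij_def Metric_space.topspace_mtopology PiE_def
        bij_betw_def)


section \<open>The space of representations\<close>

text \<open>Homomorphisms are made extensional, so that they are points of the product
  \<open>Iso(M)\<^sup>\<Gamma>\<close>.\<close>

definition Rep :: "('g, 'b) monoid_scheme \<Rightarrow> 'a set \<Rightarrow> ('a \<Rightarrow> 'a \<Rightarrow> real) \<Rightarrow> ('g \<Rightarrow> 'a \<Rightarrow> 'a) set" where
  "Rep \<Gamma> M d = hom \<Gamma> (Iso M d) \<inter> extensional (carrier \<Gamma>)"

definition Rep_topology ::
    "('g, 'b) monoid_scheme \<Rightarrow> 'a set \<Rightarrow> ('a \<Rightarrow> 'a \<Rightarrow> real) \<Rightarrow> ('g \<Rightarrow> 'a \<Rightarrow> 'a) topology" where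
  "Rep_topology \<Gamma> M d =
     subtopology (product_topology (\<lambda>_. Iso_topology M d) (carrier \<Gamma>)) (Rep \<Gamma> M d)"

definition conj_action ::
    "('g, 'b) monoid_scheme \<Rightarrow> 'a set \<Rightarrow> ('a \<Rightarrow> 'a \<Rightarrow> real) \<Rightarrow>
     ('a \<Rightarrow> 'a) \<Rightarrow> ('g \<Rightarrow> 'a \<Rightarrow> 'a) \<Rightarrow> ('g \<Rightarrow> 'a \<Rightarrow> 'a)" where
  "conj_action \<Gamma> M d g =
     (\<lambda>\<pi>\<in>Rep \<Gamma> M d. \<lambda>\<gamma>\<in>carrier \<Gamma>. g \<otimes>\<^bsub>Iso M d\<^esub> \<pi> \<gamma> \<otimes>\<^bsub>Iso M d\<^esub> inv\<^bsub>Iso M d\<^esub> g)"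

definition conjugacy_classes ::
    "('g, 'b) monoid_scheme \<Rightarrow> 'a set \<Rightarrow> ('a \<Rightarrow> 'a \<Rightarrow> real) \<Rightarrow> ('g \<Rightarrow> 'a \<Rightarrow> 'a) set set" where
  "conjugacy_classes \<Gamma> M d = orbits (Iso M d) (Rep \<Gamma> M d) (conj_action \<Gamma> M d)"

lemma topspace_Rep_topology:
  "Metric_space M d \<Longrightarrow> topspace (Rep_topology \<Gamma> M d) = Rep \<Gamma> M d"
  by (auto simp: Rep_topology_def Rep_def topspace_Iso_topology hom_def PiE_def)

lemma conj_action_closed:
  assumes "group \<Gamma>" "g \<in> carrier (Iso M d)" "\<pi> \<in> Rep \<Gamma> M d"
  shows "conj_action \<Gamma> M d g \<pi> \<in> Rep \<Gamma> M d"
proof -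
  interpret I: group "Iso M d" by (rule group_Iso)
  interpret G: group \<Gamma> by fact
  have c: "\<pi> x \<in> carrier (Iso M d)" if "x \<in> carrier \<Gamma>" for x
    using assms(3) that by (auto simp: Rep_def hom_def)
  have m: "\<pi> (x \<otimes>\<^bsub>\<Gamma>\<^esub> y) = \<pi> x \<otimes>\<^bsub>Iso M d\<^esub> \<pi> y" if "x \<in> carrier \<Gamma>" "y \<in> carrier \<Gamma>" for x y
    using assms(3) that by (auto simp: Rep_def hom_def)
  have k: "inv\<^bsub>Iso M d\<^esub> g \<otimes>\<^bsub>Iso M d\<^esub> (g \<otimes>\<^bsub>Iso M d\<^esub> z) = z" if "z \<in> carrier (Iso M d)" for z
    using assms(2) that by (simp add: I.m_assoc[symmetric])
  show ?thesis
    using assms(2,3) c unfolding Rep_def[of _ _ _] conj_action_def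
    by (auto simp: hom_def Rep_def m I.m_assoc k)
qed

lemma group_action_conj_action:
  assumes "group \<Gamma>"
  shows "group_action (Iso M d) (Rep \<Gamma> M d) (conj_action \<Gamma> M d)"
proof -
  interpret I: group "Iso M d" by (rule group_Iso)
  let ?R = "Rep \<Gamma> M d" and ?c = "conj_action \<Gamma> M d"
  have c: "\<pi> x \<in> carrier (Iso M d)" if "x \<in> carrier \<Gamma>" "\<pi> \<in> ?R" for x \<pi>
    using that by (auto simp: Rep_def hom_def)
  have mult: "?c (g \<otimes>\<^bsub>Iso M d\<^esub> h) \<pi> = ?c g (?c h \<pi>)"
    if "g \<in> carrier (Iso M d)" "h \<in> carrier (Iso M d)" "\<pi> \<in> ?R" for g h \<pi>
  proof -
    have "?c h \<pi> \<in> ?R" using conj_action_closed assms that by blast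
    then have "?c g (?c h \<pi>) = (\<lambda>\<gamma>\<in>carrier \<Gamma>. g \<otimes>\<^bsub>Iso M d\<^esub> ?c h \<pi> \<gamma> \<otimes>\<^bsub>Iso M d\<^esub> inv\<^bsub>Iso M d\<^esub> g)"
      by (simp add: conj_action_def[of _ _ _ g])
    also have "\<dots> = ?c (g \<otimes>\<^bsub>Iso M d\<^esub> h) \<pi>"
      unfolding conj_action_def using that c[OF _ that(3)]
      by (auto simp: I.m_assoc I.inv_mult_group)
    finally show ?thesis by simp
  qed
  have one: "?c \<one>\<^bsub>Iso M d\<^esub> \<pi> = \<pi>" if "\<pi> \<in> ?R" for \<pi>
    using that c[OF _ that] unfolding conj_action_def
    by (auto simp: Rep_def extensional_def)
  have bij: "?c g \<in> Bij ?R" if g: "g \<in> carrier (Iso M d)" for g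
  proof -
    have "bij_betw (?c g) ?R ?R"
      by (rule bij_betw_byWitness[where f' = "?c (inv\<^bsub>Iso M d\<^esub> g)"])
        (use g mult[of "inv\<^bsub>Iso M d\<^esub> g" g, symmetric] mult[of g "inv\<^bsub>Iso M d\<^esub> g", symmetric]
           conj_action_closed[OF assms, of g M d] conj_action_closed[OF assms, of "inv\<^bsub>Iso M d\<^esub> g" M d] one
          in \<open>auto\<close>)
    then show ?thesis by (auto simp: Bij_def conj_action_def)
  qed
  have "?c \<in> hom (Iso M d) (BijGroup ?R)"
  proof (rule homI)
    fix g h assume gh: "g \<in> carrier (Iso M d)" "h \<in> carrier (Iso M d)"
    have "?c (g \<otimes>\<^bsub>Iso M d\<^esub> h) \<pi> = compose ?R (?c g) (?c h) \<pi>" for \<pi>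
      using mult[OF gh] by (cases "\<pi> \<in> ?R") (auto simp: compose_def conj_action_def)
    then show "?c (g \<otimes>\<^bsub>Iso M d\<^esub> h) = ?c g \<otimes>\<^bsub>BijGroup ?R\<^esub> ?c h"
      using bij gh by (auto simp: BijGroup_def)
  qed (use bij in \<open>auto simp: BijGroup_def\<close>)
  then show ?thesis
    by (simp add: group_action_def group_hom_def group_hom_axioms_def group_Iso group_BijGroup)
qed

end

theory Submission
  imports Defs
begin

text \<open>
  Fix a base point \<open>x\<close> and consider the displacement function \<open>\<gamma> \<mapsto> d (\<pi> \<gamma> x) x\<close> of a
  representation \<open>\<pi>\<close>. Conjugating \<open>\<pi>\<close> by \<open>g\<close> amounts to replacing \<open>x\<close> by \<open>g\<inverse> x\<close>, and moving the
  base point by \<open>r\<close> changes displacements by at most \<open>2 r\<close>. So all displacement functions that occur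
  in the conjugacy class of \<open>\<pi>\<^sub>0\<close> are controlled by \<open>\<pi>\<^sub>0\<close> alone. On the other hand
  (\<open>displacement_dense\<close>) every nonempty open set of representations contains, for all but finitely
  many \<open>\<gamma>\<close>, some \<open>\<pi>'\<close> whose displacement at \<open>\<gamma>\<close> is almost a prescribed value \<open>c\<close>. For the Urysohn
  space \<open>c\<close> may be any integer that is large enough for the open set; for the Urysohn sphere \<open>c\<close> may
  be \<open>1\<close> or \<open>1/2\<close>. Nowhere dense sets covering the class result from a dichotomy.

  For the Urysohn space, suppose first that \<open>\<pi>\<^sub>0\<close> has bounded displacement along an infinite set
  \<open>A \<subseteq> \<Gamma>\<close>. Then every conjugate has bounded displacement along \<open>A\<close>, and for each bound this defines a
  nowhere dense set, because large values can be prescribed on \<open>A\<close>. Otherwise the displacement of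
  \<open>\<pi>\<^sub>0\<close> tends to infinity. The displacement of a conjugate stays above that of \<open>\<pi>\<^sub>0\<close> minus a
  constant, and for each constant this is again a nowhere dense condition, because one value can be
  prescribed first and \<open>\<gamma>\<close> be taken so far out afterwards that \<open>\<pi>\<^sub>0\<close> displaces by much more.

  For the Urysohn sphere the cases are whether some point \<open>y\<close> is displaced by more than \<open>3/4\<close> along
  an infinite set \<open>A\<close>. If so, every conjugate displaces some point of a countable dense set by at
  least \<open>5/8\<close> along \<open>A\<close>, which is nowhere dense for each point since \<open>1/2\<close> can be prescribed. If not,
  every conjugate displaces \<open>x\<close> by at most \<open>3/4\<close> off a finite set, which is nowhere dense for each
  finite set since \<open>1\<close> can be prescribed.

  For the density statement, the orbits of finitely many points under \<open>\<pi>\<close> give an invariant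
  pseudometric on finitely many copies of \<open>\<Gamma>\<close>. It is rounded to rational values and squeezed between
  two bounds that depend on a word length: near the identity the bounds leave the pseudometric almost
  unchanged, far out they both equal \<open>c\<close> (\<open>perturbed_metric\<close>). Adding one free orbit after the other,
  the resulting free \<open>\<Gamma>\<close>-space is enlarged to a countable one that realises all rational one-point
  extensions (\<open>free_action_with_extensions\<close>). A back-and-forth argument identifies it with the
  Fraisse limit, placing the given orbit points near their old positions (\<open>nearly_isometric_copy\<close>,
  \<open>back_and_forth\<close>), and the action passes to the completion (\<open>action_extends\<close>).
\<close>

section \<open>Metric spaces with distances in a scale\<close>

text \<open>Unlike the locale \<^locale>\<open>Metric_space\<close>, this constrains the distance function on \<open>Z\<close> only; the distance
  functions below are built in stages and are arbitrary outside the stage that has been reached.\<close>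

definition metric_over :: "real set \<Rightarrow> 'a set \<Rightarrow> ('a \<Rightarrow> 'a \<Rightarrow> real) \<Rightarrow> bool" where
  "metric_over D Z s \<longleftrightarrow>
     (\<forall>x\<in>Z. \<forall>y\<in>Z. s x y \<in> D \<and> 0 \<le> s x y \<and> (s x y = 0 \<longleftrightarrow> x = y) \<and> s x y = s y x) \<and>
     (\<forall>x\<in>Z. \<forall>y\<in>Z. \<forall>z\<in>Z. s x z \<le> s x y + s y z)"

lemma metric_overD:
  assumes "metric_over D Z s" "x \<in> Z" "y \<in> Z"
  shows "s x y \<in> D" "0 \<le> s x y" "s x y = 0 \<longleftrightarrow> x = y" "s x y = s y x"
  using assms by (auto simp: metric_over_def)

lemma metric_over_triangle:
  "metric_over D Z s \<Longrightarrow> x \<in> Z \<Longrightarrow> y \<in> Z \<Longrightarrow> z \<in> Z \<Longrightarrow> s x z \<le> s x y + s y z"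
  by (auto simp: metric_over_def)

text \<open>The common features of \<open>\<rat>\<close> and \<open>\<rat> \<inter> {0..1}\<close> that let both spaces be treated at once: a rational
  distance may be truncated at any element of the scale.\<close>

definition distance_scale :: "real set \<Rightarrow> bool" where
  "distance_scale D \<longleftrightarrow> D \<subseteq> \<rat> \<and> 1 \<in> D \<and> (\<forall>x\<in>D. \<forall>q\<in>\<rat>. 0 \<le> q \<and> q \<le> x \<longrightarrow> q \<in> D)"

text \<open>Exactly the functions \<open>f\<close> for which adding to \<open>A\<close> one new point at distances \<open>f\<close> gives a metric space with
  the new distances in \<open>D\<close>.\<close>

definition Katetov_over :: "real set \<Rightarrow> 'a set \<Rightarrow> ('a \<Rightarrow> 'a \<Rightarrow> real) \<Rightarrow> ('a \<Rightarrow> real) \<Rightarrow> bool" where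
  "Katetov_over D A s f \<longleftrightarrow> (\<forall>a\<in>A. f a \<in> D \<and> 0 < f a) \<and>
     (\<forall>a\<in>A. \<forall>b\<in>A. f a \<le> f b + s a b \<and> s a b \<le> f a + f b)"

definition has_extensions :: "real set \<Rightarrow> 'a set \<Rightarrow> ('a \<Rightarrow> 'a \<Rightarrow> real) \<Rightarrow> bool" where
  "has_extensions D Z s \<longleftrightarrow>
     (\<forall>A f. finite A \<and> A \<subseteq> Z \<and> Katetov_over D A s f \<longrightarrow> (\<exists>z\<in>Z. \<forall>a\<in>A. s z a = f a))"

section \<open>Back and forth\<close>

definition partial_isometry ::
    "('a \<Rightarrow> 'a \<Rightarrow> real) \<Rightarrow> ('b \<Rightarrow> 'b \<Rightarrow> real) \<Rightarrow> ('a \<times> 'b) set \<Rightarrow> bool" where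
  "partial_isometry s e R \<longleftrightarrow> (\<forall>(a, b)\<in>R. \<forall>(a', b')\<in>R. s a a' = e b b')"

lemma partial_isometryD:
  "partial_isometry s e R \<Longrightarrow> (a, b) \<in> R \<Longrightarrow> (a', b') \<in> R \<Longrightarrow> s a a' = e b b'"
  by (auto simp: partial_isometry_def)

lemma distance_scale_abs_diff:
  assumes "distance_scale D" "x \<in> D" "y \<in> D" "0 \<le> x" "0 \<le> y"
  shows "\<bar>x - y\<bar> \<in> D"
proof -
  have "x \<in> \<rat>" "y \<in> \<rat>" using assms by (auto simp: distance_scale_def)
  then have "\<bar>x - y\<bar> \<in> \<rat>" by simp
  moreover have "\<bar>x - y\<bar> \<le> x \<or> \<bar>x - y\<bar> \<le> y" using assms by auto
  ultimately show ?thesis using assms by (auto simp: distance_scale_def)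
qed

text \<open>The forth step of the back-and-forth argument with control over the position of the new point.
  The function \<open>f b = Max {\<bar>s z a - e b' b\<bar> | (a, b') \<in> R}\<close> is the smallest function that takes the
  values \<open>s z a\<close> required on the range of \<open>R\<close> and is compatible with the triangle inequality. A point
  realising it on the range together with \<open>y0\<close> is therefore as close to \<open>y0\<close> as possible, namely at
  distance \<open>f y0\<close>.\<close>

lemma extend_partial_isometry_near:
  assumes D: "distance_scale D" and Z: "metric_over D Z s" and Y: "metric_over D Y e"
    and ext: "has_extensions D Y e"
    and R: "finite R" "R \<subseteq> Z \<times> Y" "partial_isometry s e R" and z: "z \<in> Z" and y0: "y0 \<in> Y"
  shows "\<exists>y\<in>Y. partial_isometry s e (insert (z, y) R) \<and>
           (\<forall>\<eta>. 0 \<le> \<eta> \<longrightarrow> (\<forall>(a, b)\<in>R. \<bar>s z a - e b y0\<bar> \<le> \<eta>) \<longrightarrow> e y y0 \<le> \<eta>)"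
proof (cases "R = {} \<or> z \<in> Domain R")
  case True
  then consider "R = {}" | b where "(z, b) \<in> R" by auto
  then show ?thesis
  proof cases
    case 1
    then show ?thesis
      using metric_overD[OF Z z z] metric_overD[OF Y y0 y0] y0
      by (intro bexI[of _ y0]) (auto simp: partial_isometry_def)
  next
    case 2
    then have b: "b \<in> Y" and ins: "insert (z, b) R = R" using R by auto
    have "e b y0 \<le> \<eta>" if "\<forall>(a, b)\<in>R. \<bar>s z a - e b y0\<bar> \<le> \<eta>" for \<eta>
    proof -
      have "\<bar>s z z - e b y0\<bar> \<le> \<eta>" using that 2 by blast
      then show ?thesis using metric_overD(3)[OF Z z z] by auto
    qed
    then show ?thesis using b ins R(3) by (intro bexI[of _ b]) auto
  qed
next
  case False
  define f where "f b = Max ((\<lambda>(a, b'). \<bar>s z a - e b' b\<bar>) ` R)" for b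
  have ne: "R \<noteq> {}" using False by simp
  have RY: "b \<in> Y" "a \<in> Z" if "(a, b) \<in> R" for a b using R that by auto
  have ge: "\<bar>s z a - e b' b\<bar> \<le> f b" if "(a, b') \<in> R" for a b' b
    unfolding f_def by (rule Max_ge) (use R that in \<open>auto intro!: image_eqI[of _ _ "(a, b')"]\<close>)
  have attained: "\<exists>(a, b')\<in>R. f b = \<bar>s z a - e b' b\<bar>" for b
  proof -
    have "f b \<in> (\<lambda>(a, b'). \<bar>s z a - e b' b\<bar>) ` R"
      unfolding f_def by (rule Max_in) (use R ne in auto)
    then show ?thesis by auto
  qed
  \<comment> \<open>On the range of \<open>R\<close> the maximum is attained at the pair over \<open>b\<close> itself.\<close>
  have f_eq: "f b = s z a" if "(a, b) \<in> R" for a b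
  proof -
    obtain a' b' where ab: "(a', b') \<in> R" "f b = \<bar>s z a' - e b' b\<bar>" using attained by blast
    have "e b' b = s a' a" using partial_isometryD[OF R(3) ab(1) that] by simp
    then have "f b \<le> s z a"
      using ab metric_over_triangle[OF Z z RY(2)[OF that] RY(2)[OF ab(1)]]
        metric_over_triangle[OF Z z RY(2)[OF ab(1)] RY(2)[OF that]]
        metric_over_triangle[OF Z RY(2)[OF that] z RY(2)[OF ab(1)]]
        metric_overD(4)[OF Z z RY(2)[OF that]] metric_overD(4)[OF Z RY(2)[OF that] RY(2)[OF ab(1)]]
      by linarith
    moreover have "e b b = 0" using metric_overD(3)[OF Y] RY[OF that] by blast
    then have "s z a \<le> f b" using ge[OF that, of b] by simp
    ultimately show ?thesis by simp
  qed
  have f_mem: "f b \<in> D" if b: "b \<in> Y" for b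
  proof -
    obtain a' b' where ab: "(a', b') \<in> R" "f b = \<bar>s z a' - e b' b\<bar>" using attained by blast
    then show ?thesis
      using distance_scale_abs_diff[OF D metric_overD(1)[OF Z z RY(2)[OF ab(1)]]
          metric_overD(1)[OF Y RY(1)[OF ab(1)] b]] metric_overD(2)[OF Z z RY(2)[OF ab(1)]]
          metric_overD(2)[OF Y RY(1)[OF ab(1)] b] by simp
  qed
  have f_lip: "f b \<le> f c + e b c" if b: "b \<in> Y" and c: "c \<in> Y" for b c
  proof -
    obtain a' b' where ab: "(a', b') \<in> R" "f b = \<bar>s z a' - e b' b\<bar>" using attained by blast
    show ?thesis
      using ab ge[OF ab(1), of c] metric_over_triangle[OF Y RY(1)[OF ab(1)] b c]
        metric_over_triangle[OF Y RY(1)[OF ab(1)] c b] metric_overD(4)[OF Y b c]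
      by linarith
  qed
  have f_sum: "e b c \<le> f b + f c" if b: "b \<in> Range R" and c: "c \<in> Y" for b c
  proof -
    obtain a where a: "(a, b) \<in> R" using b by auto
    show ?thesis using f_eq[OF a] ge[OF a, of c] by linarith
  qed
  have f_pos: "0 < f b" if b: "b \<in> Range R" for b
  proof -
    obtain a where a: "(a, b) \<in> R" using b by auto
    then have "z \<noteq> a" using False by auto
    then show ?thesis using f_eq[OF a] metric_overD(2,3)[OF Z z RY(2)[OF a]] by simp
  qed
  have f_nonneg: "0 \<le> f b" for b
    using attained[of b] by auto
  have f_le: "f y0 \<le> \<eta>" if "\<forall>(a, b)\<in>R. \<bar>s z a - e b y0\<bar> \<le> \<eta>" for \<eta>
    using attained[of y0] that by auto
  \<comment> \<open>If \<open>f y0 = 0\<close> then \<open>f\<close> is not positive, but in this case \<open>y0\<close> itself realises it.\<close>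
  have "\<exists>y\<in>Y. (\<forall>b\<in>Range R. e y b = f b) \<and> e y y0 = f y0"
  proof (cases "f y0 = 0")
    case True
    have "e y0 b = f b" if "b \<in> Range R" for b
    proof -
      have b: "b \<in> Y" using that R by auto
      show ?thesis
        using f_lip[OF b y0] f_sum[OF that y0] True metric_overD(4)[OF Y b y0] by linarith
    qed
    moreover have "e y0 y0 = f y0" using True metric_overD(3)[OF Y y0 y0] by simp
    ultimately show ?thesis using y0 by blast
  next
    case False
    let ?A = "insert y0 (Range R)"
    have AY: "?A \<subseteq> Y" using R y0 by auto
    have "finite ?A" using R by (simp add: finite_Range)
    moreover have "Katetov_over D ?A e f"
      unfolding Katetov_over_def
    proof (intro conjI ballI)
      fix a b assume a: "a \<in> ?A" and b: "b \<in> ?A"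
      have aY: "a \<in> Y" and bY: "b \<in> Y" using a b AY by auto
      show "f a \<le> f b + e a b" using f_lip aY bY by blast
      have "e y0 y0 = 0" using metric_overD(3)[OF Y y0 y0] by simp
      moreover have "a = y0 \<and> b = y0 \<or> a \<in> Range R \<or> b \<in> Range R" using a b by blast
      ultimately show "e a b \<le> f a + f b"
        using f_sum[OF _ bY, of a] f_sum[OF _ aY, of b] f_nonneg[of y0] metric_overD(4)[OF Y aY bY]
        by (elim disjE) simp_all
    next
      fix a assume a: "a \<in> ?A"
      show "f a \<in> D" using a AY f_mem by blast
      have "f y0 > 0" using f_nonneg[of y0] False by simp
      then show "0 < f a" using a f_pos by blast
    qed
    ultimately have "\<exists>y\<in>Y. \<forall>b\<in>?A. e y b = f b"
      by (intro ext[unfolded has_extensions_def, rule_format]) (use AY in auto)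
    then show ?thesis by blast
  qed
  then obtain y where y: "y \<in> Y" "\<And>b. b \<in> Range R \<Longrightarrow> e y b = f b" "e y y0 = f y0" by blast
  have "partial_isometry s e (insert (z, y) R)"
  proof -
    have 1: "s z a = e y b" if "(a, b) \<in> R" for a b
      using f_eq[OF that] y(2)[OF RangeI[OF that]] by simp
    moreover have "s a z = e b y" if "(a, b) \<in> R" for a b
      using 1[OF that] metric_overD(4)[OF Z z RY(2)[OF that]] metric_overD(4)[OF Y y(1) RY(1)[OF that]]
      by simp
    moreover have "s z z = e y y" using metric_overD(3)[OF Z z z] metric_overD(3)[OF Y y(1) y(1)] by simp
    ultimately show ?thesis using R(3) unfolding partial_isometry_def by auto
  qed
  moreover have "\<forall>\<eta>. 0 \<le> \<eta> \<longrightarrow> (\<forall>(a, b)\<in>R. \<bar>s z a - e b y0\<bar> \<le> \<eta>) \<longrightarrow> e y y0 \<le> \<eta>"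
    unfolding y(3) using f_le by blast
  ultimately show ?thesis using y(1) by (intro bexI[of _ y] conjI)
qed

lemma extend_partial_isometry:
  assumes "distance_scale D" "metric_over D Z s" "metric_over D Y e" "has_extensions D Y e"
    and "finite R" "R \<subseteq> Z \<times> Y" "partial_isometry s e R" "z \<in> Z"
  shows "\<exists>y\<in>Y. partial_isometry s e (insert (z, y) R)"
proof -
  obtain y0 where "y0 \<in> Y"
    using assms(4)[unfolded has_extensions_def, rule_format, of "{}" undefined]
    by (auto simp: Katetov_over_def)
  from extend_partial_isometry_near[OF assms this] show ?thesis by (elim bexE conjE) (rule bexI)
qed

lemma partial_isometry_converse:
  assumes "partial_isometry s e R"
  shows "partial_isometry e s (R\<inverse>)"
  unfolding partial_isometry_def
proof clarify
  fix a b a' b' assume "(b, a) \<in> R" "(b', a') \<in> R"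
  from partial_isometryD[OF assms this] show "e a a' = s b b'" by simp
qed

lemma back_and_forth:
  assumes D: "distance_scale D" and Z: "metric_over D Z s" and Y: "metric_over D Y e"
    and extZ: "has_extensions D Z s" and extY: "has_extensions D Y e"
    and cnt: "countable Z" "countable Y"
    and R: "finite R" "R \<subseteq> Z \<times> Y" "partial_isometry s e R"
  shows "\<exists>\<phi>. bij_betw \<phi> Z Y \<and> (\<forall>x\<in>Z. \<forall>y\<in>Z. e (\<phi> x) (\<phi> y) = s x y) \<and> (\<forall>(a, b)\<in>R. \<phi> a = b)"
proof -
  have ne: "Z \<noteq> {}" "Y \<noteq> {}"
    using extZ[unfolded has_extensions_def, rule_format, of "{}" undefined]
      extY[unfolded has_extensions_def, rule_format, of "{}" undefined]
    by (auto simp: Katetov_over_def)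
  define P where "P T \<longleftrightarrow> finite T \<and> T \<subseteq> Z \<times> Y \<and> partial_isometry s e T" for T
  define Q where "Q n T T' \<longleftrightarrow> T \<subseteq> T' \<and> from_nat_into Z n \<in> Domain T' \<and> from_nat_into Y n \<in> Range T'"
    for n T T'
  have "\<exists>T. \<forall>n. (P (T n) \<and> (n = 0 \<longrightarrow> T n = R)) \<and> Q n (T n) (T (Suc n))"
  proof (rule dependent_nat_choice)
    fix T :: "('a \<times> 'b) set" and n :: nat
    assume "P T \<and> (n = 0 \<longrightarrow> T = R)"
    then have T: "finite T" "T \<subseteq> Z \<times> Y" "partial_isometry s e T" by (auto simp: P_def)
    let ?z = "from_nat_into Z n" and ?y = "from_nat_into Y n"
    have zy: "?z \<in> Z" "?y \<in> Y" using ne by (auto intro: from_nat_into)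
    obtain y where y: "y \<in> Y" "partial_isometry s e (insert (?z, y) T)"
      using extend_partial_isometry[OF D Z Y extY T zy(1)] by blast
    have "\<exists>z\<in>Z. partial_isometry e s (insert (?y, z) ((insert (?z, y) T)\<inverse>))"
      using T y zy partial_isometry_converse[OF y(2)]
      by (intro extend_partial_isometry[OF D Y Z extZ]) auto
    then obtain z where z: "z \<in> Z" "partial_isometry e s (insert (?y, z) ((insert (?z, y) T)\<inverse>))" ..
    let ?T = "insert (z, ?y) (insert (?z, y) T)"
    have "?T = (insert (?y, z) ((insert (?z, y) T)\<inverse>))\<inverse>" by auto
    then have "partial_isometry s e ?T" using partial_isometry_converse[OF z(2)] by simp
    then show "\<exists>T'. (P T' \<and> (Suc n = 0 \<longrightarrow> T' = R)) \<and> Q n T T'"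
      using T y(1) z(1) zy by (intro exI[of _ ?T]) (auto simp: P_def Q_def)
  qed (use R in \<open>auto simp: P_def\<close>)
  then obtain T where T: "\<And>n. P (T n)" "T 0 = R" "\<And>n. Q n (T n) (T (Suc n))" by blast
  have mono: "T m \<subseteq> T n" if "m \<le> n" for m n
    using that by (rule lift_Suc_mono_le[rotated]) (use T(3) in \<open>auto simp: Q_def\<close>)
  define U where "U = (\<Union>n. T n)"
  have U_iso: "s a a' = e b b'" if U: "(a, b) \<in> U" "(a', b') \<in> U" for a b a' b'
  proof -
    obtain m n where "(a, b) \<in> T m" "(a', b') \<in> T n" using U unfolding U_def by blast
    then have "(a, b) \<in> T (max m n)" "(a', b') \<in> T (max m n)"
      using mono[of m "max m n"] mono[of n "max m n"] by auto
    moreover have "partial_isometry s e (T (max m n))" using T(1) by (simp add: P_def)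
    ultimately show ?thesis using partial_isometryD by metis
  qed
  have U_sub: "U \<subseteq> Z \<times> Y" using T(1) by (auto simp: U_def P_def)
  have "\<exists>b. (a, b) \<in> U" if a: "a \<in> Z" for a
  proof -
    obtain n where "a = from_nat_into Z n" using from_nat_into_surj[OF cnt(1) a] by blast
    then have "a \<in> Domain (T (Suc n))" using T(3) by (auto simp: Q_def)
    then show ?thesis by (auto simp: U_def)
  qed
  then obtain \<phi> where \<phi>: "\<And>a. a \<in> Z \<Longrightarrow> (a, \<phi> a) \<in> U" by metis
  have sur: "\<exists>a. (a, b) \<in> U" if b: "b \<in> Y" for b
  proof -
    obtain n where "b = from_nat_into Y n" using from_nat_into_surj[OF cnt(2) b] by blast
    then have "b \<in> Range (T (Suc n))" using T(3) by (auto simp: Q_def)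
    then show ?thesis by (auto simp: U_def)
  qed
  have uniq: "\<phi> a = b" if "(a, b) \<in> U" for a b
  proof -
    have a: "a \<in> Z" and b: "b \<in> Y" "\<phi> a \<in> Y" using that U_sub \<phi> by auto
    have "e (\<phi> a) b = s a a" using U_iso[OF \<phi>[OF a] that] by simp
    then show ?thesis using metric_overD(3)[OF Z a a] metric_overD(3)[OF Y b(2,1)] by simp
  qed
  have iso: "e (\<phi> x) (\<phi> y) = s x y" if "x \<in> Z" "y \<in> Z" for x y
    using U_iso \<phi> that by metis
  have "inj_on \<phi> Z"
  proof (rule inj_onI)
    fix x y assume xy: "x \<in> Z" "y \<in> Z" "\<phi> x = \<phi> y"
    have "\<phi> y \<in> Y" using \<phi> xy U_sub by auto
    then show "x = y"
      using iso[OF xy(1,2)] xy metric_overD(3)[OF Y, of "\<phi> y" "\<phi> y"] metric_overD(3)[OF Z xy(1,2)] by simp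
  qed
  moreover have "\<phi> ` Z = Y"
  proof
    show "\<phi> ` Z \<subseteq> Y" using \<phi> U_sub by auto
    show "Y \<subseteq> \<phi> ` Z"
    proof
      fix b assume "b \<in> Y"
      then obtain a where "(a, b) \<in> U" using sur by blast
      then show "b \<in> \<phi> ` Z" using uniq U_sub by (metis SigmaD1 image_eqI subsetD)
    qed
  qed
  ultimately have "bij_betw \<phi> Z Y" by (simp add: bij_betw_def)
  moreover have "R \<subseteq> U" using T(2) unfolding U_def by blast
  then have "\<forall>(a, b)\<in>R. \<phi> a = b" using uniq by blast
  ultimately show ?thesis using iso by blast
qed

text \<open>If \<open>q\<close> distorts distances by at most \<open>\<epsilon>\<close>, the points are moved one at a time to exact positions.
  The points moved before have errors of their own, so each step may add \<open>\<epsilon>\<close> to the error;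
  hence the factor \<open>card P\<close>.\<close>

lemma nearly_isometric_copy:
  fixes q :: "'p \<Rightarrow> 'a"
  assumes D: "distance_scale D" and Z: "metric_over D Z s" and Y: "metric_over D Y e"
    and ext: "has_extensions D Y e"
    and P: "finite P" "P \<subseteq> Z" "\<And>p. p \<in> P \<Longrightarrow> q p \<in> Y"
    and eps: "0 \<le> \<epsilon>" "\<And>p r. p \<in> P \<Longrightarrow> r \<in> P \<Longrightarrow> \<bar>s p r - e (q p) (q r)\<bar> \<le> \<epsilon>"
  shows "\<exists>R. finite R \<and> R \<subseteq> Z \<times> Y \<and> partial_isometry s e R \<and>
    (\<forall>p\<in>P. \<exists>y. (p, y) \<in> R \<and> e y (q p) \<le> real (card P) * \<epsilon>)"
proof -
  have "\<exists>R. finite R \<and> R \<subseteq> P' \<times> Y \<and> partial_isometry s e R \<and> Domain R = P' \<and>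
    (\<forall>(r, y)\<in>R. e y (q r) \<le> real (card P') * \<epsilon>)" if "P' \<subseteq> P" for P'
    using finite_subset[OF that P(1)] that
  proof (induction P' rule: finite_induct)
    case empty
    then show ?case by (intro exI[of _ "{}"]) (auto simp: partial_isometry_def)
  next
    case (insert p F)
    have "F \<subseteq> P" using insert.prems by blast
    from insert.IH[OF this] obtain R where R: "finite R" "R \<subseteq> F \<times> Y" "partial_isometry s e R"
        "Domain R = F" and "\<forall>(r, y)\<in>R. e y (q r) \<le> real (card F) * \<epsilon>" by (elim exE conjE)
    then have near: "\<And>r y. (r, y) \<in> R \<Longrightarrow> e y (q r) \<le> real (card F) * \<epsilon>" by auto
    have RZ: "R \<subseteq> Z \<times> Y" using R insert.prems P by blast
    have p: "p \<in> P" "p \<in> Z" "q p \<in> Y" using insert.prems P by auto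
    obtain y where y: "y \<in> Y" "partial_isometry s e (insert (p, y) R)" and
      est': "\<forall>\<eta>. 0 \<le> \<eta> \<longrightarrow> (\<forall>(a, b)\<in>R. \<bar>s p a - e b (q p)\<bar> \<le> \<eta>) \<longrightarrow> e y (q p) \<le> \<eta>"
      using extend_partial_isometry_near[OF D Z Y ext R(1) RZ R(3) p(2,3)] by (elim bexE conjE)
    have new: "e y (q p) \<le> real (card F) * \<epsilon> + \<epsilon>"
    proof (rule est'[THEN spec, THEN mp, THEN mp])
      show "\<forall>(a, b)\<in>R. \<bar>s p a - e b (q p)\<bar> \<le> real (card F) * \<epsilon> + \<epsilon>"
      proof clarify
        fix a b assume ab: "(a, b) \<in> R"
        have a: "a \<in> P" "q a \<in> Y" and b: "b \<in> Y" using ab R insert.prems P by auto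
        show "\<bar>s p a - e b (q p)\<bar> \<le> real (card F) * \<epsilon> + \<epsilon>"
          using near[OF ab] eps(2)[OF p(1) a(1)] metric_over_triangle[OF Y b a(2) p(3)]
            metric_over_triangle[OF Y a(2) b p(3)] metric_overD(4)[OF Y b a(2)]
            metric_overD(4)[OF Y a(2) p(3)] by linarith
      qed
    qed (use eps in auto)
    have card: "real (card (insert p F)) * \<epsilon> = real (card F) * \<epsilon> + \<epsilon>"
      using insert.hyps by (simp add: algebra_simps)
    have "e b (q a) \<le> real (card F) * \<epsilon> + \<epsilon>" if "(a, b) \<in> R" for a b
      using near[OF that] eps(1) by linarith
    then have "\<forall>(r, b)\<in>insert (p, y) R. e b (q r) \<le> real (card (insert p F)) * \<epsilon>"
      unfolding card using new by blast
    moreover have "insert (p, y) R \<subseteq> insert p F \<times> Y" "Domain (insert (p, y) R) = insert p F"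
      using R(2,4) y(1) by auto
    ultimately show ?case
      using R(1) y(2) by (intro exI[of _ "insert (p, y) R"] conjI) simp_all
  qed
  from this[OF order_refl] obtain R where R: "finite R" "R \<subseteq> P \<times> Y" "partial_isometry s e R"
    "Domain R = P" "\<forall>(p, y)\<in>R. e y (q p) \<le> real (card P) * \<epsilon>" by (elim exE conjE)
  have "\<exists>y. (p, y) \<in> R \<and> e y (q p) \<le> real (card P) * \<epsilon>" if "p \<in> P" for p
    using that R(4,5) by auto
  moreover have "R \<subseteq> Z \<times> Y" using R(2) P(2) by blast
  ultimately show ?thesis using R(1,3) by (intro exI[of _ R] conjI ballI)
qed

section \<open>Fraisse limits realise one-point extensions\<close>

lemma metric_over_Metric_space:
  assumes "Metric_space Q d" "\<And>x y. x \<in> Q \<Longrightarrow> y \<in> Q \<Longrightarrow> d x y \<in> D"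
  shows "metric_over D Q d"
proof -
  interpret Metric_space Q d by fact
  show ?thesis using assms(2) by (auto simp: metric_over_def commute triangle)
qed

lemma Fraisse_limit_metric_over:
  assumes "Fraisse_limit_over D Q d"
  shows "metric_over D Q d"
proof (rule metric_over_Metric_space)
  show "Metric_space Q d" using assms by (simp add: Fraisse_limit_over_def)
  fix x y assume "x \<in> Q" "y \<in> Q"
  then have "{x, y} \<subseteq> Q \<and> finite {x, y}" by simp
  then have "finite_metric_space_over D {x, y} d"
    using assms unfolding Fraisse_limit_over_def by metis
  then show "d x y \<in> D" by (simp add: finite_metric_space_over_def)
qed

text \<open>The one-point extension of \<open>A\<close> given by \<open>f\<close> is a finite space of the class, so it embeds; by
  homogeneity the embedding can be corrected to fix \<open>A\<close>.\<close>

lemma Fraisse_limit_has_extensions: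
  assumes D: "0 \<in> D" and F: "Fraisse_limit_over D Q d"
  shows "has_extensions D Q d"
  unfolding has_extensions_def
proof (intro allI impI, elim conjE)
  fix A and f :: "'a \<Rightarrow> real"
  assume A: "finite A" "A \<subseteq> Q" and K: "Katetov_over D A d f"
  have M: "metric_over D Q d" by (rule Fraisse_limit_metric_over[OF F])
  define n where "n = card A"
  obtain h where h: "bij_betw h {..<n} A"
    using ex_bij_betw_nat_finite[OF A(1)] by (auto simp: n_def atLeast0LessThan)
  have hA: "h i \<in> A" "h i \<in> Q" if "i < n" for i
    using bij_betw_apply[OF h, of i] A that by auto
  have h_inj: "h i = h j \<longleftrightarrow> i = j" if "i < n" "j < n" for i j
    using h that by (auto simp: bij_betw_def inj_on_def)
  \<comment> \<open>The space \<open>A\<close> is copied to \<open>{..<n}\<close>, and \<open>n\<close> is the new point.\<close>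
  define e where "e i j = (if i < n \<and> j < n then d (h i) (h j)
      else if i < n then f (h i) else if j < n then f (h j) else 0)"
    for i j :: nat
  define e' where "e' i j = (if i \<le> n \<and> j \<le> n then e i j else 0)" for i j
  have Kf: "f a \<in> D" "0 < f a" if "a \<in> A" for a
    using K that by (auto simp: Katetov_over_def)
  have Kd: "f a \<le> f b + d a b" "d a b \<le> f a + f b" if "a \<in> A" "b \<in> A" for a b
    using K that by (auto simp: Katetov_over_def)
  have nonneg: "0 \<le> e' i j" for i j
    using metric_overD(2)[OF M hA(2) hA(2)] Kf(2)[OF hA(1)] by (auto simp: e'_def e_def less_imp_le)
  have comm: "e' i j = e' j i" for i j
    using metric_overD(4)[OF M hA(2) hA(2), of i j] by (auto simp: e'_def e_def)
  have cases_n: "i = n \<or> i < n" if "i \<in> {..n}" for i using that by auto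
  have "Metric_space {..n} e'"
  proof
    show "0 \<le> e' i j" "e' i j = e' j i" for i j by (fact nonneg comm)+
    show "e' i j = 0 \<longleftrightarrow> i = j" if "i \<in> {..n}" "j \<in> {..n}" for i j
      using cases_n[OF that(1)] cases_n[OF that(2)] metric_overD(3)[OF M hA(2) hA(2), of i j]
        h_inj[of i j] Kf(2)[OF hA(1), of i] Kf(2)[OF hA(1), of j]
      by (auto simp: e'_def e_def)
    show "e' i k \<le> e' i j + e' j k" if "i \<in> {..n}" "j \<in> {..n}" "k \<in> {..n}" for i j k
      using cases_n[OF that(1)] cases_n[OF that(2)] cases_n[OF that(3)]
        metric_over_triangle[OF M hA(2) hA(2) hA(2), of i j k]
        Kd[OF hA(1) hA(1), of i j] Kd[OF hA(1) hA(1), of j k] Kd[OF hA(1) hA(1), of i k]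
        Kd[OF hA(1) hA(1), of k j] Kd[OF hA(1) hA(1), of j i]
        metric_overD(4)[OF M hA(2) hA(2), of k j] metric_overD(2)[OF M hA(2) hA(2), of i k]
        Kf(2)[OF hA(1), of i] Kf(2)[OF hA(1), of j] Kf(2)[OF hA(1), of k]
      by (elim disjE) (simp_all add: e'_def e_def)
  qed
  moreover have "e' i j \<in> D" if "i \<in> {..n}" "j \<in> {..n}" for i j
    using that cases_n[OF that(1)] cases_n[OF that(2)] metric_overD(1)[OF M hA(2) hA(2), of i j]
      Kf(1)[OF hA(1), of i] Kf(1)[OF hA(1), of j] D
    by (elim disjE) (simp_all add: e'_def e_def)
  ultimately have "finite_metric_space_over D {..n} e'" by (simp add: finite_metric_space_over_def)
  then obtain g where g: "g ` {..n} \<subseteq> Q" "isometric_on {..n} e' d g"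
    using F unfolding Fraisse_limit_over_def by blast
  have gQ: "g i \<in> Q" if "i \<le> n" for i using g(1) that by auto
  have g_iso: "d (g i) (g j) = e' i j" if "i \<le> n" "j \<le> n" for i j
    using g(2) that by (simp add: isometric_on_def)
  have g_inj: "inj_on g {..<n}"
  proof (rule inj_onI)
    fix i j assume ij: "i \<in> {..<n}" "j \<in> {..<n}" "g i = g j"
    then have "e' i j = 0" using g_iso[of i j] metric_overD(3)[OF M gQ gQ, of j j] by simp
    then show "i = j" using ij metric_overD(3)[OF M hA(2) hA(2), of i j] h_inj by (simp add: e'_def e_def)
  qed
  \<comment> \<open>The partial isometry of \<open>Q\<close> that takes the embedded copy of \<open>A\<close> back to \<open>A\<close>.\<close>
  define k where "k = h \<circ> inv_into {..<n} g"
  have k: "k (g i) = h i" if "i < n" for i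
    using that g_inj by (simp add: k_def inv_into_f_f)
  have "g ` {..<n} \<subseteq> Q \<and> finite (g ` {..<n}) \<and> k ` (g ` {..<n}) \<subseteq> Q \<and> isometric_on (g ` {..<n}) d d k"
  proof (intro conjI)
    show "k ` (g ` {..<n}) \<subseteq> Q" using k hA by auto
    show "isometric_on (g ` {..<n}) d d k"
      using k g_iso by (auto simp: isometric_on_def e'_def e_def)
  qed (use gQ in auto)
  then obtain l where l: "bij_betw l Q Q" "isometric_on Q d d l" "\<forall>x\<in>g ` {..<n}. l x = k x"
    using F unfolding Fraisse_limit_over_def by metis
  show "\<exists>z\<in>Q. \<forall>a\<in>A. d z a = f a"
  proof (intro bexI ballI)
    show "l (g n) \<in> Q" using bij_betw_apply[OF l(1) gQ[of n]] by simp
    fix a assume "a \<in> A"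
    then obtain i where i: "i < n" "a = h i" using h by (auto simp: bij_betw_def)
    have "d (l (g n)) (l (g i)) = d (g n) (g i)"
      using l(2) gQ i by (simp add: isometric_on_def)
    also have "\<dots> = f a" using g_iso[of n i] i by (simp add: e'_def e_def)
    finally show "d (l (g n)) a = f a" using l(3) k i by simp
  qed
qed

section \<open>Free group actions on spaces with one-point extensions\<close>

text \<open>The free action of \<open>\<Gamma>\<close> on copies of itself, one copy for each index.\<close>

definition shift :: "('g, 'b) monoid_scheme \<Rightarrow> 'g \<Rightarrow> 'g \<times> 'i \<Rightarrow> 'g \<times> 'i" where
  "shift \<Gamma> g p = (g \<otimes>\<^bsub>\<Gamma>\<^esub> fst p, snd p)"

definition shift_invariant ::
    "('g, 'b) monoid_scheme \<Rightarrow> 'i set \<Rightarrow> ('g \<times> 'i \<Rightarrow> 'g \<times> 'i \<Rightarrow> real) \<Rightarrow> bool" where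
  "shift_invariant \<Gamma> I s \<longleftrightarrow> (\<forall>g\<in>carrier \<Gamma>. \<forall>p\<in>carrier \<Gamma> \<times> I. \<forall>q\<in>carrier \<Gamma> \<times> I.
     s (shift \<Gamma> g p) (shift \<Gamma> g q) = s p q)"

lemma shift_invariantD:
  "shift_invariant \<Gamma> I s \<Longrightarrow> g \<in> carrier \<Gamma> \<Longrightarrow> p \<in> carrier \<Gamma> \<times> I \<Longrightarrow> q \<in> carrier \<Gamma> \<times> I \<Longrightarrow>
     s (shift \<Gamma> g p) (shift \<Gamma> g q) = s p q"
  unfolding shift_invariant_def by blast

lemma snd_shift [simp]: "snd (shift \<Gamma> g p) = snd p"
  by (simp add: shift_def)

context group
begin

lemma shift_in: "g \<in> carrier G \<Longrightarrow> p \<in> carrier G \<times> I \<Longrightarrow> shift G g p \<in> carrier G \<times> I"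
  by (auto simp: shift_def)

lemma shift_mult:
  "g \<in> carrier G \<Longrightarrow> h \<in> carrier G \<Longrightarrow> p \<in> carrier G \<times> I \<Longrightarrow>
     shift G (g \<otimes> h) p = shift G g (shift G h p)"
  by (auto simp: shift_def m_assoc)

lemma shift_one: "p \<in> carrier G \<times> I \<Longrightarrow> shift G \<one> p = p"
  by (auto simp: shift_def)

lemma shift_inv: "g \<in> carrier G \<Longrightarrow> p \<in> carrier G \<times> I \<Longrightarrow> shift G (inv g) (shift G g p) = p"
  using shift_mult[of "inv g" g p I] shift_one[of p I] by simp

text \<open>Adds the free orbit \<open>{(g, n) | g \<in> \<Gamma>}\<close> so that \<open>(\<one>, n)\<close> has distances \<open>f\<close> from \<open>A\<close>. The point
  \<open>(g, n)\<close> is attached to the old space by edges of length \<open>f a\<close> to its feet \<open>g a\<close>, \<open>a \<in> A\<close>, and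
  distances are shortest paths, truncated at \<open>B\<close>. The Katetov inequality \<open>s a b \<le> f a + f b\<close> says
  that no detour through a new point is a short cut, so old distances survive. Treating an old point
  as its own foot at distance \<open>0\<close> makes all cases of the triangle inequality the same.\<close>

lemma orbit_extension:
  fixes n :: nat
  assumes D: "distance_scale D" and s: "metric_over D (carrier G \<times> {..<n}) s"
    and inv: "shift_invariant G {..<n} s"
    and B: "B \<in> D" "\<And>p q. p \<in> carrier G \<times> {..<n} \<Longrightarrow> q \<in> carrier G \<times> {..<n} \<Longrightarrow> s p q \<le> B"
    and A: "finite A" "A \<noteq> {}" "A \<subseteq> carrier G \<times> {..<n}"
    and f: "Katetov_over D A s f" "\<And>a. a \<in> A \<Longrightarrow> f a \<le> B"
  shows "\<exists>s'. metric_over D (carrier G \<times> {..<Suc n}) s' \<and> shift_invariant G {..<Suc n} s' \<and>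
    (\<forall>p\<in>carrier G \<times> {..<Suc n}. \<forall>q\<in>carrier G \<times> {..<Suc n}. s' p q \<le> B) \<and>
    (\<forall>p\<in>carrier G \<times> {..<n}. \<forall>q\<in>carrier G \<times> {..<n}. s' p q = s p q) \<and>
    (\<forall>a\<in>A. s' (\<one>, n) a = f a)"
proof -
  let ?L = "carrier G \<times> {..<n}" and ?L' = "carrier G \<times> {..<Suc n}"
  \<comment> \<open>Pairs of an old point and its distance to \<open>p\<close>.\<close>
  define feet where "feet p = (if snd p < n then {(p, 0)} else (\<lambda>a. (shift G (fst p) a, f a)) ` A)" for p
  define t where "t p q = Min ((\<lambda>((z, r), (w, u)). r + s z w + u) ` (feet p \<times> feet q))" for p q
  define s' where "s' p q = (if p = q then 0 else min B (t p q))" for p q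
  have fD: "f a \<in> D" "0 < f a" if "a \<in> A" for a using f(1) that by (auto simp: Katetov_over_def)
  have fK: "f a \<le> f b + s a b" "s a b \<le> f a + f b" if "a \<in> A" "b \<in> A" for a b
    using f(1) that by (auto simp: Katetov_over_def)
  have D_rat: "x \<in> \<rat>" if "x \<in> D" for x using D that by (auto simp: distance_scale_def)
  obtain a0 where a0: "a0 \<in> A" using A(2) by blast
  have B_pos: "0 < B" using fD(2)[OF a0] f(2)[OF a0] by linarith
  have L_sub: "p \<in> ?L'" if "p \<in> ?L" for p using that by auto
  have feet_fin: "finite (feet p)" and feet_ne: "feet p \<noteq> {}" for p
    using A by (auto simp: feet_def)
  have feet_old: "feet p = {(p, 0)}" if "p \<in> ?L" for p using that by (auto simp: feet_def)
  have feet_in: "z \<in> ?L" "0 \<le> r" "r \<in> \<rat>" if fp: "(z, r) \<in> feet p" "p \<in> ?L'" for z r p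
  proof -
    have "z \<in> ?L \<and> 0 \<le> r \<and> r \<in> \<rat>"
    proof (cases "snd p < n")
      case True
      then show ?thesis using fp by (auto simp: feet_def)
    next
      case False
      then obtain a where a: "a \<in> A" "z = shift G (fst p) a" "r = f a" using fp by (auto simp: feet_def)
      have "a \<in> ?L" using a A(3) by blast
      then have "z \<in> ?L" using a fp shift_in[of "fst p" a] by auto
      then show ?thesis using a fD[OF a(1)] D_rat by simp
    qed
    then show "z \<in> ?L" "0 \<le> r" "r \<in> \<rat>" by auto
  qed
  have feet_zero: "z = p" if fp: "(z, r) \<in> feet p" "r = 0" for z r p
  proof (cases "snd p < n")
    case True
    then show ?thesis using that by (auto simp: feet_def)
  next
    case False
    then obtain a where "a \<in> A" "r = f a" using fp(1) by (auto simp: feet_def)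
    then show ?thesis using fD(2)[of a] fp(2) by simp
  qed
  have feet_sep: "s z z' \<le> r + r'" if fp: "(z, r) \<in> feet p" "(z', r') \<in> feet p" "p \<in> ?L'" for z r z' r' p
  proof (cases "snd p < n")
    case True
    then have "z = z'" "r = 0" "r' = 0" using that by (auto simp: feet_def)
    then show ?thesis using metric_overD(3)[OF s feet_in(1)[OF fp(1,3)] feet_in(1)[OF fp(2,3)]] by simp
  next
    case False
    obtain a where a: "a \<in> A" "z = shift G (fst p) a" "r = f a"
      using fp(1) False by (auto simp: feet_def)
    obtain a' where a': "a' \<in> A" "z' = shift G (fst p) a'" "r' = f a'"
      using fp(2) False by (auto simp: feet_def)
    have "fst p \<in> carrier G" "a \<in> ?L" "a' \<in> ?L" using that(3) a a' A(3) by auto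
    then have "s z z' = s a a'" using shift_invariantD[OF inv] a a' by metis
    then show ?thesis using fK(2)[OF a(1) a'(1)] a a' by simp
  qed
  have feet_shift: "(shift G g z, r) \<in> feet (shift G g p)"
    if fp: "(z, r) \<in> feet p" "p \<in> ?L'" "g \<in> carrier G" for z r p g
  proof (cases "snd p < n")
    case True
    then show ?thesis using that by (auto simp: feet_def)
  next
    case False
    obtain a where a: "a \<in> A" "z = shift G (fst p) a" "r = f a"
      using fp(1) False by (auto simp: feet_def)
    have "a \<in> ?L" "fst p \<in> carrier G" using A(3) a that(2) by auto
    then have "shift G g z = shift G (fst (shift G g p)) a"
      using shift_mult[of g "fst p" a] that(3) a by (simp add: shift_def)
    then show ?thesis using False a by (auto simp: feet_def)
  qed
  have t_le: "t p q \<le> r + s z w + u" if "(z, r) \<in> feet p" "(w, u) \<in> feet q" for p q z r w u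
    unfolding t_def
    by (rule Min_le) (use that feet_fin in \<open>auto intro!: image_eqI[of _ _ "((z, r), (w, u))"]\<close>)
  have t_att: "\<exists>z r w u. (z, r) \<in> feet p \<and> (w, u) \<in> feet q \<and> t p q = r + s z w + u" for p q
  proof -
    have "t p q \<in> (\<lambda>((z, r), (w, u)). r + s z w + u) ` (feet p \<times> feet q)"
      unfolding t_def by (rule Min_in) (use feet_fin feet_ne in auto)
    then show ?thesis by (auto simp del: split_paired_Ex)
  qed
  have t_nonneg: "0 \<le> t p q" and t_pos: "p \<noteq> q \<Longrightarrow> 0 < t p q" and t_rat: "t p q \<in> \<rat>"
    if pq: "p \<in> ?L'" "q \<in> ?L'" for p q
  proof -
    obtain z r w u where *: "(z, r) \<in> feet p" "(w, u) \<in> feet q" "t p q = r + s z w + u"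
      using t_att by blast
    note z = feet_in[OF *(1) pq(1)] and w = feet_in[OF *(2) pq(2)]
    have sn: "0 \<le> s z w" "s z w \<in> \<rat>" using metric_overD(1,2)[OF s z(1) w(1)] D_rat by auto
    show "0 \<le> t p q" using *(3) z(2) w(2) sn by linarith
    show "t p q \<in> \<rat>" using *(3) z(3) w(3) sn by simp
    show "0 < t p q" if "p \<noteq> q"
    proof (cases "r = 0 \<and> u = 0")
      case True
      then have "z \<noteq> w" using feet_zero * \<open>p \<noteq> q\<close> by metis
      then show ?thesis using *(3) z(2) w(2) sn metric_overD(3)[OF s z(1) w(1)] by linarith
    next
      case False
      then show ?thesis using *(3) z(2) w(2) sn by linarith
    qed
  qed
  have t_sym_le: "t q p \<le> t p q" if pq: "p \<in> ?L'" "q \<in> ?L'" for p q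
  proof -
    obtain z r w u where *: "(z, r) \<in> feet p" "(w, u) \<in> feet q" "t p q = r + s z w + u"
      using t_att by blast
    then show ?thesis
      using t_le[OF *(2,1)] metric_overD(4)[OF s feet_in(1)[OF *(1) pq(1)] feet_in(1)[OF *(2) pq(2)]] by linarith
  qed
  have t_tri: "t p q \<le> t p x + t x q" if pqx: "p \<in> ?L'" "q \<in> ?L'" "x \<in> ?L'" for p q x
  proof -
    obtain z r w u where 1: "(z, r) \<in> feet p" "(w, u) \<in> feet x" "t p x = r + s z w + u"
      using t_att by blast
    obtain z' r' w' u' where 2: "(z', r') \<in> feet x" "(w', u') \<in> feet q" "t x q = r' + s z' w' + u'"
      using t_att by blast
    note zs = feet_in(1)[OF 1(1) pqx(1)] feet_in(1)[OF 1(2) pqx(3)] feet_in(1)[OF 2(1) pqx(3)]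
      feet_in(1)[OF 2(2) pqx(2)]
    show ?thesis
      using 1(3) 2(3) t_le[OF 1(1) 2(2)] feet_sep[OF 1(2) 2(1) pqx(3)]
        metric_over_triangle[OF s zs(1) zs(2) zs(4)] metric_over_triangle[OF s zs(2) zs(3) zs(4)]
      by linarith
  qed
  have t_shift_le: "t (shift G g p) (shift G g q) \<le> t p q"
    if pq: "p \<in> ?L'" "q \<in> ?L'" and g: "g \<in> carrier G" for p q g
  proof -
    obtain z r w u where *: "(z, r) \<in> feet p" "(w, u) \<in> feet q" "t p q = r + s z w + u"
      using t_att by blast
    show ?thesis
      using t_le[OF feet_shift[OF *(1) pq(1) g] feet_shift[OF *(2) pq(2) g]] *(3)
        shift_invariantD[OF inv g feet_in(1)[OF *(1) pq(1)] feet_in(1)[OF *(2) pq(2)]] by simp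
  qed
  have t_shift: "t (shift G g p) (shift G g q) = t p q"
    if pq: "p \<in> ?L'" "q \<in> ?L'" and g: "g \<in> carrier G" for p q g
    using t_shift_le[OF pq g] t_shift_le[OF shift_in[OF g pq(1)] shift_in[OF g pq(2)] inv_closed[OF g]]
      shift_inv[OF g pq(1)] shift_inv[OF g pq(2)] by simp
  have "metric_over D ?L' s'"
    unfolding metric_over_def
  proof (intro conjI ballI)
    fix p q assume pq: "p \<in> ?L'" "q \<in> ?L'"
    show n: "0 \<le> s' p q" using t_nonneg[OF pq] B_pos by (simp add: s'_def)
    show "s' p q \<in> D"
    proof -
      have "s' p q \<in> \<rat>" using t_rat[OF pq] D_rat[OF B(1)] by (simp add: s'_def min_def)
      moreover have "s' p q \<le> B" using B_pos by (simp add: s'_def)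
      ultimately show ?thesis using D B(1) n by (auto simp: distance_scale_def)
    qed
    show "s' p q = 0 \<longleftrightarrow> p = q" using t_pos[OF pq] B_pos by (auto simp: s'_def min_def)
    show "s' p q = s' q p" using t_sym_le[OF pq] t_sym_le[OF pq(2,1)] by (simp add: s'_def)
    fix x assume x: "x \<in> ?L'"
    show "s' p x \<le> s' p q + s' q x"
      using t_tri[OF pq(1) x pq(2)] t_nonneg[OF pq] t_nonneg[OF pq(2) x] t_nonneg[OF pq(1) x] B_pos
      by (auto simp: s'_def min_def)
  qed
  moreover have "shift_invariant G {..<Suc n} s'"
    unfolding shift_invariant_def
  proof (intro ballI)
    fix g p q assume g: "g \<in> carrier G" and pq: "p \<in> ?L'" "q \<in> ?L'"
    have "shift G g p = shift G g q \<longleftrightarrow> p = q" using shift_inv[OF g pq(1)] shift_inv[OF g pq(2)] by metis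
    then show "s' (shift G g p) (shift G g q) = s' p q" using t_shift[OF pq g] by (simp add: s'_def)
  qed
  moreover have "s' p q \<le> B" for p q using B_pos by (simp add: s'_def)
  moreover have "s' p q = s p q" if "p \<in> ?L" "q \<in> ?L" for p q
    using B(2)[OF that] feet_old[OF that(1)] feet_old[OF that(2)] metric_overD(3)[OF s that(2) that(2)]
    by (simp add: s'_def t_def)
  moreover have "s' (\<one>, n) a = f a" if a: "a \<in> A" for a
  proof -
    have aL: "a \<in> ?L" using a A(3) by blast
    have sh: "shift G \<one> b = b" if "b \<in> A" for b using shift_one[of b] A(3) that by blast
    have feet1: "feet (\<one>, n) = (\<lambda>b. (b, f b)) ` A" using sh by (simp add: feet_def)
    have "t (\<one>, n) a \<le> f a"
      using t_le[of a "f a" "(\<one>, n)" a 0 a] feet1 a feet_old[OF aL] metric_overD(3)[OF s aL aL] by simp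
    moreover obtain z r w u where *: "(z, r) \<in> feet (\<one>, n)" "(w, u) \<in> feet a" "t (\<one>, n) a = r + s z w + u"
      using t_att by blast
    then have "z \<in> A" "r = f z" "w = a" "u = 0" using feet1 feet_old[OF aL] by auto
    then have "f a \<le> t (\<one>, n) a"
      using * fK(1)[OF a, of z] aL A(3) metric_overD(4)[OF s aL, of z] by auto
    moreover have "(\<one>, n) \<noteq> a" using aL by auto
    ultimately show ?thesis using f(2)[OF a] by (simp add: s'_def)
  qed
  ultimately show ?thesis by (intro exI[of _ s']) blast
qed

text \<open>The extension problems over \<open>\<Gamma> \<times> \<nat>\<close> with distances in \<open>D\<close> are countably many, since each is a finite
  list of points with values in \<open>D\<close>. Stage \<open>n\<close> adds one orbit, which solves the problem decoded from
  \<open>n\<close>. Every problem comes up at arbitrarily late stages, in particular after all its points have been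
  added.\<close>

lemma free_action_with_extensions:
  fixes k :: nat
  assumes D: "distance_scale D" and cnt: "countable (carrier G)" and k: "0 < k"
    and s: "metric_over D (carrier G \<times> {..<k}) s" and inv: "shift_invariant G {..<k} s"
    and B: "B \<in> D" "\<And>p q. p \<in> carrier G \<times> {..<k} \<Longrightarrow> q \<in> carrier G \<times> {..<k} \<Longrightarrow> s p q \<le> B"
  shows "\<exists>S. metric_over D (carrier G \<times> UNIV) S \<and> shift_invariant G UNIV S \<and>
    has_extensions D (carrier G \<times> UNIV) S \<and>
    (\<forall>p\<in>carrier G \<times> {..<k}. \<forall>q\<in>carrier G \<times> {..<k}. S p q = s p q)"
proof -
  let ?L = "\<lambda>n. carrier G \<times> {..<k + n}"
  define T where "T = lists ((carrier G \<times> (UNIV :: nat set)) \<times> D)"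
  have "countable D" using D countable_rat countable_subset by (auto simp: distance_scale_def)
  then have T_cnt: "countable T" using cnt unfolding T_def by (intro countable_lists countable_SIGMA) auto
  define pts where "pts n = fst ` set (from_nat_into T (fst (prod_decode n)))" for n
  define val where "val n = the \<circ> map_of (from_nat_into T (fst (prod_decode n)))" for n
  define P where "P n \<sigma> \<longleftrightarrow> metric_over D (?L n) \<sigma> \<and> shift_invariant G {..<k + n} \<sigma> \<and>
    (\<exists>B\<in>D. \<forall>p\<in>?L n. \<forall>q\<in>?L n. \<sigma> p q \<le> B) \<and> (n = 0 \<longrightarrow> \<sigma> = s)" for n \<sigma>
  define Q where "Q n \<sigma> \<sigma>' \<longleftrightarrow> (\<forall>p\<in>?L n. \<forall>q\<in>?L n. \<sigma>' p q = \<sigma> p q) \<and>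
    (pts n \<subseteq> ?L n \<and> pts n \<noteq> {} \<and> Katetov_over D (pts n) \<sigma> (val n) \<longrightarrow>
      (\<exists>z\<in>?L (Suc n). \<forall>a\<in>pts n. \<sigma>' z a = val n a))" for n \<sigma> \<sigma>'
  have "\<exists>\<sigma>. \<forall>n. P n (\<sigma> n) \<and> Q n (\<sigma> n) (\<sigma> (Suc n))"
  proof (rule dependent_nat_choice)
    show "\<exists>\<sigma>. P 0 \<sigma>" using s inv B by (intro exI[of _ s]) (unfold P_def add_0_right, blast)
    fix \<sigma> n assume "P n \<sigma>"
    then have \<sigma>: "metric_over D (?L n) \<sigma>" "shift_invariant G {..<k + n} \<sigma>"
      and "\<exists>B\<in>D. \<forall>p\<in>?L n. \<forall>q\<in>?L n. \<sigma> p q \<le> B" by (auto simp: P_def)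
    then obtain B where B: "B \<in> D" "\<And>p q. p \<in> ?L n \<Longrightarrow> q \<in> ?L n \<Longrightarrow> \<sigma> p q \<le> B" by blast
    define ok where "ok \<longleftrightarrow> pts n \<subseteq> ?L n \<and> pts n \<noteq> {} \<and> Katetov_over D (pts n) \<sigma> (val n)"
    \<comment> \<open>If the problem decoded from \<open>n\<close> cannot be posed at this stage, any other one will do.\<close>
    define A where "A = (if ok then pts n else {(\<one>, 0)})"
    define f where "f = (if ok then val n else (\<lambda>_. 1))"
    have one: "(1 :: real) \<in> D" using D by (simp add: distance_scale_def)
    have oneL: "(\<one>, 0) \<in> ?L n" using k by simp
    have A: "finite A" "A \<noteq> {}" "A \<subseteq> ?L n" using oneL by (auto simp: A_def ok_def pts_def)
    have K: "Katetov_over D A \<sigma> f"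
      using one metric_overD(3)[OF \<sigma>(1) oneL oneL] by (auto simp: A_def f_def ok_def Katetov_over_def)
    \<comment> \<open>The diameter bound may have to grow with \<open>f\<close>; it stays in \<open>D\<close> as a maximum of elements of \<open>D\<close>.\<close>
    define B' where "B' = Max (insert B (f ` A))"
    have "B' \<in> insert B (f ` A)" unfolding B'_def by (rule Max_in) (use A in auto)
    then have B'D: "B' \<in> D" using B(1) K by (auto simp: Katetov_over_def)
    have B'_ge: "B \<le> B'" "\<And>a. a \<in> A \<Longrightarrow> f a \<le> B'" unfolding B'_def using A(1) by auto
    have "\<sigma> p q \<le> B'" if "p \<in> ?L n" "q \<in> ?L n" for p q using B(2)[OF that] B'_ge(1) by linarith
    from orbit_extension[OF D \<sigma> B'D this A K B'_ge(2)]
    obtain \<sigma>' where \<sigma>': "metric_over D (?L (Suc n)) \<sigma>'" "shift_invariant G {..<k + Suc n} \<sigma>'"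
      "\<forall>p\<in>?L (Suc n). \<forall>q\<in>?L (Suc n). \<sigma>' p q \<le> B'"
      "\<forall>p\<in>?L n. \<forall>q\<in>?L n. \<sigma>' p q = \<sigma> p q" "\<forall>a\<in>A. \<sigma>' (\<one>, k + n) a = f a"
      by auto
    have "P (Suc n) \<sigma>'" unfolding P_def using \<sigma>' B'D by blast
    moreover have "\<exists>z\<in>?L (Suc n). \<forall>a\<in>pts n. \<sigma>' z a = val n a" if ok
    proof
      show "\<forall>a\<in>pts n. \<sigma>' (\<one>, k + n) a = val n a" using \<sigma>'(5) that by (simp add: A_def f_def)
    qed simp
    then have "Q n \<sigma> \<sigma>'" unfolding Q_def ok_def using \<sigma>'(4) by blast
    ultimately show "\<exists>\<sigma>'. P (Suc n) \<sigma>' \<and> Q n \<sigma> \<sigma>'" by blast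
  qed
  then obtain \<sigma> where \<sigma>P: "\<And>n. P n (\<sigma> n)" and \<sigma>Q: "\<And>n. Q n (\<sigma> n) (\<sigma> (Suc n))" by blast
  have L_mono: "p \<in> ?L n" if "p \<in> ?L m" "m \<le> n" for p m n using that by auto
  have agree: "\<sigma> n p q = \<sigma> m p q" if "m \<le> n" "p \<in> ?L m" "q \<in> ?L m" for m n p q
    using that(1)
  proof (induction n rule: dec_induct)
    case (step i)
    have "p \<in> ?L i" "q \<in> ?L i" using L_mono that(2,3) step.hyps(1) by blast+
    then have "\<sigma> (Suc i) p q = \<sigma> i p q" using \<sigma>Q[of i] unfolding Q_def by blast
    then show ?case using step.IH by simp
  qed simp
  \<comment> \<open>Stage \<open>Suc n\<close> contains all orbits with index at most \<open>n\<close>.\<close>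
  define S where "S p q = \<sigma> (Suc (max (snd p) (snd q))) p q" for p q
  have S_eq: "S p q = \<sigma> n p q" if "p \<in> ?L n" "q \<in> ?L n" for n p q
  proof -
    define m where "m = Suc (max (snd p) (snd q))"
    have m: "p \<in> ?L m" "q \<in> ?L m" using that by (auto simp: m_def)
    have "\<sigma> (max m n) p q = \<sigma> m p q" "\<sigma> (max m n) p q = \<sigma> n p q"
      using agree[OF max.cobounded1 m] agree[OF max.cobounded2 that] by blast+
    then show ?thesis by (simp add: S_def m_def)
  qed
  have in_L: "p \<in> ?L (Suc (snd p + j))" if "p \<in> carrier G \<times> UNIV" for p j using that by auto
  have "metric_over D (carrier G \<times> UNIV) S"
    unfolding metric_over_def
  proof (intro conjI ballI)
    fix p q :: "'a \<times> nat" assume pq: "p \<in> carrier G \<times> UNIV" "q \<in> carrier G \<times> UNIV"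
    have 1: "p \<in> ?L (Suc (snd p + snd q))" "q \<in> ?L (Suc (snd p + snd q))"
      using in_L[OF pq(1), of "snd q"] in_L[OF pq(2), of "snd p"] by (simp_all add: add.commute)
    have m: "metric_over D (?L (Suc (snd p + snd q))) (\<sigma> (Suc (snd p + snd q)))"
      using \<sigma>P[of "Suc (snd p + snd q)"] unfolding P_def by blast
    note d = metric_overD[OF m 1] S_eq[OF 1] S_eq[OF 1(2) 1(1)]
    show "S p q \<in> D" "0 \<le> S p q" "S p q = 0 \<longleftrightarrow> p = q" "S p q = S q p" using d by simp_all
    fix x assume x: "x \<in> carrier G \<times> (UNIV :: nat set)"
    let ?m = "Suc (snd p + snd q + snd x)"
    have 2: "p \<in> ?L ?m" "q \<in> ?L ?m" "x \<in> ?L ?m" using pq x by auto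
    have m': "metric_over D (?L ?m) (\<sigma> ?m)" using \<sigma>P[of ?m] unfolding P_def by blast
    show "S p x \<le> S p q + S q x"
      unfolding S_eq[OF 2(1,2)] S_eq[OF 2(1,3)] S_eq[OF 2(2,3)]
      by (rule metric_over_triangle[OF m' 2])
  qed
  moreover have "shift_invariant G UNIV S"
    unfolding shift_invariant_def
  proof (intro ballI)
    fix g and p q :: "'a \<times> nat"
    assume g: "g \<in> carrier G" and pq: "p \<in> carrier G \<times> UNIV" "q \<in> carrier G \<times> UNIV"
    let ?m = "Suc (snd p + snd q)"
    have 1: "p \<in> ?L ?m" "q \<in> ?L ?m" using pq by auto
    have i: "shift_invariant G {..<k + ?m} (\<sigma> ?m)" using \<sigma>P[of ?m] unfolding P_def by blast
    show "S (shift G g p) (shift G g q) = S p q"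
      unfolding S_eq[OF 1] S_eq[OF shift_in[OF g 1(1)] shift_in[OF g 1(2)]]
      by (rule shift_invariantD[OF i g 1])
  qed
  moreover have "has_extensions D (carrier G \<times> UNIV) S"
    unfolding has_extensions_def
  proof (intro allI impI, elim conjE)
    fix A and f :: "'a \<times> nat \<Rightarrow> real"
    assume A: "finite A" "A \<subseteq> carrier G \<times> UNIV" and K: "Katetov_over D A S f"
    show "\<exists>z\<in>carrier G \<times> UNIV. \<forall>a\<in>A. S z a = f a"
    proof (cases "A = {}")
      case True
      then show ?thesis by (intro bexI[of _ "(\<one>, 0)"]) auto
    next
      case False
      obtain xs where xs: "set xs = A" using finite_list[OF A(1)] by blast
      define l where "l = map (\<lambda>a. (a, f a)) xs"
      have "l \<in> T" using xs A(2) K by (auto simp: l_def T_def Katetov_over_def)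
      then obtain i where i: "from_nat_into T i = l" using from_nat_into_surj[OF T_cnt] by blast
      define j where "j = Suc (Max (snd ` A))"
      \<comment> \<open>The second component only serves to delay the problem until the orbits below \<open>j\<close> exist.\<close>
      define n where "n = prod_encode (i, j)"
      have "j \<le> n" by (simp add: n_def le_prod_encode_2)
      have "snd a < j" if "a \<in> A" for a using A(1) that by (simp add: j_def less_Suc_eq_le)
      then have AL: "A \<subseteq> ?L n" using A(2) \<open>j \<le> n\<close> by (fastforce simp: subset_iff)
      have pts: "pts n = A" using xs i by (simp add: pts_def n_def l_def image_image)
      have val: "val n a = f a" if "a \<in> A" for a
        using that xs i by (simp add: val_def n_def l_def map_of_map_restrict)
      have SA: "S a b = \<sigma> n a b" if "a \<in> A" "b \<in> A" for a b using S_eq that AL by blast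
      have "Katetov_over D (pts n) (\<sigma> n) (val n)"
        using K SA val unfolding pts Katetov_over_def by simp
      then obtain z where z: "z \<in> ?L (Suc n)" "\<forall>a\<in>A. \<sigma> (Suc n) z a = f a"
        using \<sigma>Q[of n] AL False val unfolding Q_def pts by auto
      have "S z a = f a" if "a \<in> A" for a
      proof -
        have "a \<in> ?L (Suc n)" using AL that L_mono[of a n "Suc n"] by auto
        then show ?thesis using S_eq[OF z(1)] z(2) that by simp
      qed
      then show ?thesis using z(1) by (intro bexI[of _ z]) auto
    qed
  qed
  moreover have "S p q = s p q" if "p \<in> carrier G \<times> {..<k}" "q \<in> carrier G \<times> {..<k}" for p q
    using S_eq[of p 0 q] that \<sigma>P[of 0] by (simp add: P_def)
  ultimately show ?thesis by blast
qed

end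

section \<open>Word length and perturbation of an invariant pseudometric\<close>

context group
begin

text \<open>Words of length exactly \<open>n\<close>. An element may occur for several \<open>n\<close>; its word length is the least one.\<close>

primrec word_ball :: "'a set \<Rightarrow> nat \<Rightarrow> 'a set" where
  "word_ball S 0 = {\<one>}"
| "word_ball S (Suc n) = (\<lambda>(x, y). x \<otimes> y) ` (word_ball S n \<times> S)"

lemma word_ball_sub: "S \<subseteq> carrier G \<Longrightarrow> word_ball S n \<subseteq> carrier G"
  by (induction n) auto

lemma word_ball_mult:
  assumes "S \<subseteq> carrier G" "x \<in> word_ball S m" "y \<in> word_ball S n"
  shows "x \<otimes> y \<in> word_ball S (m + n)"
  using assms(3)
proof (induction n arbitrary: y)
  case 0
  have "x \<in> carrier G" using assms(1,2) word_ball_sub by blast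
  then show ?case using 0 assms(2) by simp
next
  case (Suc n)
  then obtain z s where z: "z \<in> word_ball S n" "s \<in> S" "y = z \<otimes> s" by auto
  have "x \<in> carrier G" "z \<in> carrier G" "s \<in> carrier G" using assms z word_ball_sub by blast+
  then have "x \<otimes> y = (x \<otimes> z) \<otimes> s" using z(3) by (simp add: m_assoc)
  then show ?case using Suc.IH[OF z(1)] z(2) by auto
qed

lemma word_ball_one: "S \<subseteq> carrier G \<Longrightarrow> word_ball S (Suc 0) = S"
  by (force simp: image_iff)

lemma word_ball_inv:
  assumes "S \<subseteq> carrier G" "\<And>s. s \<in> S \<Longrightarrow> inv s \<in> S" "x \<in> word_ball S n"
  shows "inv x \<in> word_ball S n"
  using assms(3)
proof (induction n arbitrary: x)
  case (Suc n)
  then obtain z s where z: "z \<in> word_ball S n" "s \<in> S" "x = z \<otimes> s" by auto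
  have "z \<in> carrier G" "s \<in> carrier G" using assms z word_ball_sub by blast+
  then have "inv x = inv s \<otimes> inv z" using z(3) by (simp add: inv_mult_group)
  moreover have "inv s \<in> word_ball S (Suc 0)" using assms z(2) word_ball_one by blast
  ultimately show ?case using word_ball_mult[OF assms(1) _ Suc.IH[OF z(1)]] by fastforce
qed simp

text \<open>Word length with respect to \<open>F\<close>, cut off at \<open>K\<close>. Elements outside the subgroup generated by \<open>F\<close> get
  the value \<open>K\<close>, so that it is attained off a finite set in all cases.\<close>

lemma truncated_word_length:
  assumes F: "finite F" "F \<subseteq> carrier G" and K: "0 < K"
  obtains w :: "'a \<Rightarrow> nat" where "\<And>g. g \<in> carrier G \<Longrightarrow> w g = 0 \<longleftrightarrow> g = \<one>"
    "\<And>g. g \<in> carrier G \<Longrightarrow> w (inv g) = w g"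
    "\<And>g h. g \<in> carrier G \<Longrightarrow> h \<in> carrier G \<Longrightarrow> w (g \<otimes> h) \<le> w g + w h"
    "\<And>f. f \<in> F \<Longrightarrow> w f \<le> 1" "\<And>g. w g \<le> K" "finite {g \<in> carrier G. w g < K}"
proof -
  define S where "S = F \<union> m_inv G ` F"
  have S: "S \<subseteq> carrier G" "finite S" "\<And>s. s \<in> S \<Longrightarrow> inv s \<in> S" using F by (auto simp: S_def)
  define w where "w g = (LEAST n. n = K \<or> g \<in> word_ball S n)" for g
  have w: "w g = K \<or> g \<in> word_ball S (w g)" for g
    unfolding w_def by (rule LeastI[of _ K]) simp
  have w_le: "w g \<le> K" for g unfolding w_def by (rule Least_le) simp
  have w_ball: "w g \<le> n" if "g \<in> word_ball S n" for g n
    unfolding w_def by (rule Least_le) (simp add: that)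
  have "w g = 0 \<longleftrightarrow> g = \<one>" for g using w[of g] w_ball[of g 0] K by auto
  moreover have inv_le: "w (inv g) \<le> w g" for g
    using w[of g] w_le[of "inv g"] w_ball word_ball_inv[OF S(1,3)] by auto
  have "w (inv g) = w g" if "g \<in> carrier G" for g
    using inv_le[of g] inv_le[of "inv g"] that by simp
  moreover have "w (g \<otimes> h) \<le> w g + w h" for g h
    using w[of g] w[of h] w_le[of "g \<otimes> h"] w_ball word_ball_mult[OF S(1)] by fastforce
  moreover have "w f \<le> 1" if "f \<in> F" for f
    using w_ball[of f "Suc 0"] word_ball_one[OF S(1)] that by (simp add: S_def)
  moreover have "finite {g \<in> carrier G. w g < K}"
  proof (rule finite_subset)
    show "{g \<in> carrier G. w g < K} \<subseteq> (\<Union>n<K. word_ball S n)" using w by force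
    have "finite (word_ball S n)" for n by (induction n) (use S in auto)
    then show "finite (\<Union>n<K. word_ball S n)" by blast
  qed
  ultimately show ?thesis using w_le by (intro that[of w])
qed

end

text \<open>The value \<open>r\<close> forced into the interval from \<open>min c l\<close> to \<open>m - min (m - c) l\<close>. As \<open>l\<close> grows from
  \<open>0\<close> to \<open>m\<close>, this interval shrinks from \<open>[0, m]\<close> to \<open>{c}\<close>.\<close>

definition squeeze :: "real \<Rightarrow> real \<Rightarrow> real \<Rightarrow> real \<Rightarrow> real" where
  "squeeze c m l r = max (min c l) (min r (m - min (m - c) l))"

text \<open>If \<open>r2\<close> is cut down to the upper bound belonging to \<open>l2\<close>, the triangle inequality survives because the
  upper bounds for \<open>l1\<close> and \<open>l2\<close> differ by at most the lower bound for \<open>l3\<close>; this is where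
  \<open>m - c \<le> c\<close> enters.\<close>

lemma squeeze_triangle:
  assumes "c \<le> m" "m \<le> 2 * c" "0 \<le> l1" "0 \<le> l2" "0 \<le> l3"
    and "l1 \<le> l2 + l3" "l2 \<le> l1 + l3" "l3 \<le> l1 + l2" "r1 \<le> r2 + r3" "0 \<le> r2" "0 \<le> r3"
  shows "squeeze c m l1 r1 \<le> squeeze c m l2 r2 + squeeze c m l3 r3"
proof -
  have u: "m - min (m - c) l1 \<le> (m - min (m - c) l2) + min c l3"
    "m - min (m - c) l1 \<le> (m - min (m - c) l3) + min c l2"
    "min c l1 \<le> min c l2 + min c l3" "0 \<le> min c l2" "0 \<le> min c l3"
    using assms by (auto simp: min_def)
  have ge: "min c l \<le> squeeze c m l r \<and> (r \<le> squeeze c m l r \<or> m - min (m - c) l \<le> squeeze c m l r)"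
    and le: "squeeze c m l r \<le> min c l \<or> squeeze c m l r \<le> r \<and> squeeze c m l r \<le> m - min (m - c) l"
    for l r by (auto simp: squeeze_def)
  show ?thesis
    using ge[of l2 r2] ge[of l3 r3] le[of l1 r1] u assms(9-11) by linarith
qed

lemma squeeze_near:
  assumes "0 \<le> l" "l \<le> \<delta>" "0 \<le> r" "r \<le> m" "c \<le> m" "0 \<le> c"
  shows "\<bar>squeeze c m l r - r\<bar> \<le> \<delta>"
  using assms by (auto simp: squeeze_def min_def max_def)

lemma squeeze_far: "m \<le> l \<Longrightarrow> 0 \<le> c \<Longrightarrow> c \<le> m \<Longrightarrow> squeeze c m l r = c"
  by (auto simp: squeeze_def min_def max_def)

lemma squeeze_bounds:
  assumes "0 \<le> l" "0 \<le> r" "0 < c" "c \<le> m"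
  shows "0 \<le> squeeze c m l r" "squeeze c m l r \<le> m" "l \<noteq> 0 \<Longrightarrow> 0 < squeeze c m l r" "squeeze c m 0 0 = 0"
  using assms by (auto simp: squeeze_def min_def max_def)

lemma squeeze_Rats: "c \<in> \<rat> \<Longrightarrow> m \<in> \<rat> \<Longrightarrow> l \<in> \<rat> \<Longrightarrow> r \<in> \<rat> \<Longrightarrow> squeeze c m l r \<in> \<rat>"
  by (simp add: squeeze_def min_def max_def)

context group
begin

text \<open>The pseudometric \<open>\<rho>\<close>, rounded up to multiples of \<open>1 / N\<close>, is squeezed with
  respect to \<open>1 / N\<close> times a word length on \<open>G\<close>. Elements \<open>inv f \<otimes> g\<close> with
  \<open>f, g \<in> H\<close> have word length at most \<open>1\<close>, so over \<open>H\<close> the change is of order \<open>1 / N\<close>; where the word length reaches \<open>N * m\<close>, the new distance is \<open>c\<close>.\<close>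

lemma perturbed_metric:
  fixes k N m :: nat and c :: real and \<rho> :: "'a \<times> nat \<Rightarrow> 'a \<times> nat \<Rightarrow> real"
  assumes D: "distance_scale D" and H: "finite H" "H \<subseteq> carrier G" and N: "0 < N" and k: "0 < k"
    and m: "0 < m" "real m \<in> D" and c: "c = m \<or> c = m / 2"
    and \<rho>: "\<And>p q. p \<in> carrier G \<times> {..<k} \<Longrightarrow> q \<in> carrier G \<times> {..<k} \<Longrightarrow> 0 \<le> \<rho> p q"
      "\<And>p. p \<in> carrier G \<times> {..<k} \<Longrightarrow> \<rho> p p = 0"
      "\<And>p q. p \<in> carrier G \<times> {..<k} \<Longrightarrow> q \<in> carrier G \<times> {..<k} \<Longrightarrow> \<rho> p q = \<rho> q p"
      "\<And>p q r. p \<in> carrier G \<times> {..<k} \<Longrightarrow> q \<in> carrier G \<times> {..<k} \<Longrightarrow> r \<in> carrier G \<times> {..<k} \<Longrightarrow>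
        \<rho> p r \<le> \<rho> p q + \<rho> q r"
    and inv: "shift_invariant G {..<k} \<rho>"
    and bound: "\<And>p q. p \<in> H \<times> {..<k} \<Longrightarrow> q \<in> H \<times> {..<k} \<Longrightarrow> \<rho> p q \<le> m"
  shows "\<exists>E. finite E \<and> (\<exists>\<sigma>. metric_over D (carrier G \<times> {..<k}) \<sigma> \<and> shift_invariant G {..<k} \<sigma> \<and>
    (\<forall>p\<in>carrier G \<times> {..<k}. \<forall>q\<in>carrier G \<times> {..<k}. \<sigma> p q \<le> real m) \<and>
    (\<forall>p\<in>H \<times> {..<k}. \<forall>q\<in>H \<times> {..<k}. \<bar>\<sigma> p q - \<rho> p q\<bar> \<le> 3 / N) \<and>
    (\<forall>\<gamma>\<in>carrier G - E. \<sigma> (\<one>, 0) (\<gamma>, 0) = c))"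
proof -
  let ?Z = "carrier G \<times> {..<k}"
  \<comment> \<open>With these generators the word length of \<open>inv f \<otimes> g\<close> is at most \<open>1\<close> for \<open>f, g \<in> H\<close>.\<close>
  define F where "F = (\<lambda>(f, g). inv f \<otimes> g) ` (H \<times> H)"
  have F: "finite F" "F \<subseteq> carrier G" using H by (auto simp: F_def)
  have Nm: "0 < N * m" using N m by simp
  obtain w where w0: "\<And>g. g \<in> carrier G \<Longrightarrow> w g = 0 \<longleftrightarrow> g = \<one>"
    and w_inv: "\<And>g. g \<in> carrier G \<Longrightarrow> w (inv g) = w g"
    and w_mult: "\<And>g h. g \<in> carrier G \<Longrightarrow> h \<in> carrier G \<Longrightarrow> w (g \<otimes> h) \<le> w g + w h"
    and w_F: "\<And>f. f \<in> F \<Longrightarrow> w f \<le> 1" and w_le: "\<And>g. w g \<le> N * m"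
    and w_fin: "finite {g \<in> carrier G. w g < N * m}"
    by (fact truncated_word_length[OF F Nm])
  \<comment> \<open>The summand \<open>1\<close> separates points with different indices, where \<open>\<rho>\<close> may vanish.\<close>
  define L where "L p q = (real (w (inv (fst p) \<otimes> fst q)) + (if snd p = snd q then 0 else 1)) / N"
    for p q :: "'a \<times> nat"
  \<comment> \<open>Rounding up preserves the triangle inequality.\<close>
  define \<rho>' where "\<rho>' p q = real_of_int \<lceil>N * \<rho> p q\<rceil> / N" for p q
  define \<sigma> where "\<sigma> p q = squeeze c m (L p q) (\<rho>' p q)" for p q
  have "real m \<in> \<rat>" "real m / 2 \<in> \<rat>" by simp_all
  then have "c \<in> \<rat>" using c by blast
  then have c': "0 < c" "c \<le> m" "m \<le> 2 * c" "c \<in> \<rat>" using c m(1) by auto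
  have L_nonneg: "0 \<le> L p q" for p q by (simp add: L_def)
  have L_zero: "L p q = 0 \<longleftrightarrow> p = q" if pq: "p \<in> ?Z" "q \<in> ?Z" for p q
  proof -
    obtain g i h j where [simp]: "p = (g, i)" "q = (h, j)" by fastforce
    have gh: "g \<in> carrier G" "h \<in> carrier G" using pq by auto
    have "inv g \<otimes> h = \<one> \<longleftrightarrow> g = h"
      using gh by (metis inv_closed inv_equality inv_inv r_inv)
    then show ?thesis using gh w0[of "inv g \<otimes> h"] N by (simp add: L_def)
  qed
  have L_sym: "L p q = L q p" if "p \<in> ?Z" "q \<in> ?Z" for p q
  proof -
    have "fst p \<in> carrier G" "fst q \<in> carrier G" using that by auto
    then have "w (inv (fst p) \<otimes> fst q) = w (inv (fst q) \<otimes> fst p)"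
      using w_inv[of "inv (fst p) \<otimes> fst q"] by (simp add: inv_mult_group)
    then show ?thesis by (simp add: L_def)
  qed
  have L_tri: "L p r \<le> L p q + L q r" if "p \<in> ?Z" "q \<in> ?Z" "r \<in> ?Z" for p q r
  proof -
    have in_G: "fst p \<in> carrier G" "fst q \<in> carrier G" "fst r \<in> carrier G" using that by auto
    have "fst q \<otimes> (inv (fst q) \<otimes> fst r) = fst r" using in_G by (simp add: m_assoc[symmetric])
    then have "inv (fst p) \<otimes> fst r = (inv (fst p) \<otimes> fst q) \<otimes> (inv (fst q) \<otimes> fst r)"
      using in_G by (simp add: m_assoc)
    then have "w (inv (fst p) \<otimes> fst r) \<le> w (inv (fst p) \<otimes> fst q) + w (inv (fst q) \<otimes> fst r)"
      using w_mult in_G by simp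
    then have "real (w (inv (fst p) \<otimes> fst r)) + (if snd p = snd r then 0 else 1) \<le>
      (real (w (inv (fst p) \<otimes> fst q)) + (if snd p = snd q then 0 else 1)) +
      (real (w (inv (fst q) \<otimes> fst r)) + (if snd q = snd r then 0 else 1))" by auto
    then show ?thesis using N unfolding L_def by (simp add: add_divide_distrib[symmetric] divide_right_mono)
  qed
  have L_inv: "L (shift G g p) (shift G g q) = L p q"
    if "g \<in> carrier G" "p \<in> ?Z" "q \<in> ?Z" for g p q
  proof -
    have in_G: "fst p \<in> carrier G" "fst q \<in> carrier G" using that by auto
    have "inv (g \<otimes> fst p) \<otimes> (g \<otimes> fst q) = inv (fst p) \<otimes> (inv g \<otimes> (g \<otimes> fst q))"
      using in_G that(1) by (simp add: m_assoc inv_mult_group)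
    also have "inv g \<otimes> (g \<otimes> fst q) = fst q"
      using in_G that(1) by (simp add: m_assoc[symmetric])
    finally show ?thesis by (simp add: L_def shift_def)
  qed
  have \<rho>'_nonneg: "0 \<le> \<rho>' p q" if "p \<in> ?Z" "q \<in> ?Z" for p q
  proof -
    have "0 \<le> N * \<rho> p q" using \<rho>(1)[OF that] by simp
    then have "0 \<le> real_of_int \<lceil>N * \<rho> p q\<rceil>" using le_of_int_ceiling order_trans by blast
    then show ?thesis by (simp add: \<rho>'_def)
  qed
  have \<rho>'_tri: "\<rho>' p r \<le> \<rho>' p q + \<rho>' q r" if "p \<in> ?Z" "q \<in> ?Z" "r \<in> ?Z" for p q r
  proof -
    have "N * \<rho> p r \<le> N * (\<rho> p q + \<rho> q r)" using \<rho>(4)[OF that] by (intro mult_left_mono) auto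
    then have "\<lceil>N * \<rho> p r\<rceil> \<le> \<lceil>N * \<rho> p q\<rceil> + \<lceil>N * \<rho> q r\<rceil>"
      using ceiling_mono ceiling_add_le by (metis (no_types) distrib_left order_trans)
    then have "real_of_int \<lceil>N * \<rho> p r\<rceil> \<le> real_of_int \<lceil>N * \<rho> p q\<rceil> + real_of_int \<lceil>N * \<rho> q r\<rceil>" by linarith
    then show ?thesis using N unfolding \<rho>'_def by (simp add: add_divide_distrib[symmetric] divide_right_mono)
  qed
  have \<sigma>_le: "\<sigma> p q \<le> m" if "p \<in> ?Z" "q \<in> ?Z" for p q
    unfolding \<sigma>_def by (rule squeeze_bounds(2)) (use L_nonneg \<rho>'_nonneg[OF that] c' in auto)
  have "metric_over D ?Z \<sigma>"
    unfolding metric_over_def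
  proof (intro conjI ballI)
    fix p q assume pq: "p \<in> ?Z" "q \<in> ?Z"
    note b = squeeze_bounds[OF L_nonneg[of p q] \<rho>'_nonneg[OF pq] c'(1,2)]
    show n: "0 \<le> \<sigma> p q" using b(1) by (simp add: \<sigma>_def)
    have "\<sigma> p q \<in> \<rat>" unfolding \<sigma>_def by (rule squeeze_Rats) (use c' in \<open>auto simp: L_def \<rho>'_def\<close>)
    then show "\<sigma> p q \<in> D" using D m(2) n \<sigma>_le[OF pq] by (auto simp: distance_scale_def)
    show "\<sigma> p q = 0 \<longleftrightarrow> p = q"
    proof
      assume "p = q"
      moreover have "\<rho>' p p = 0" using \<rho>(2)[OF pq(1)] by (simp add: \<rho>'_def)
      ultimately show "\<sigma> p q = 0" using b(4) L_zero[OF pq] by (simp add: \<sigma>_def)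
    next
      assume "\<sigma> p q = 0"
      then show "p = q" using b(3) L_zero[OF pq] by (auto simp: \<sigma>_def)
    qed
    show "\<sigma> p q = \<sigma> q p" using L_sym[OF pq] \<rho>(3)[OF pq] by (simp add: \<sigma>_def \<rho>'_def)
    fix r assume r: "r \<in> ?Z"
    show "\<sigma> p r \<le> \<sigma> p q + \<sigma> q r"
      unfolding \<sigma>_def
      by (rule squeeze_triangle)
        (use c'(2,3) L_nonneg L_tri[OF pq r] L_tri[OF pq(1) r pq(2)] L_tri[OF pq(2,1) r]
          L_sym[OF pq] L_sym[OF pq(1) r] L_sym[OF pq(2) r] \<rho>'_tri[OF pq r] \<rho>'_nonneg[OF pq]
          \<rho>'_nonneg[OF pq(2) r] in simp_all)
  qed
  moreover have "shift_invariant G {..<k} \<sigma>"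
    unfolding shift_invariant_def
  proof (intro ballI)
    fix g p q assume "g \<in> carrier G" "p \<in> ?Z" "q \<in> ?Z"
    then show "\<sigma> (shift G g p) (shift G g q) = \<sigma> p q"
      using shift_invariantD[OF inv] L_inv by (simp add: \<sigma>_def \<rho>'_def)
  qed
  moreover have "\<bar>\<sigma> p q - \<rho> p q\<bar> \<le> 3 / N" if pq: "p \<in> H \<times> {..<k}" "q \<in> H \<times> {..<k}" for p q
  proof -
    have Z: "p \<in> ?Z" "q \<in> ?Z" using pq H by auto
    have "inv (fst p) \<otimes> fst q \<in> F" using pq by (force simp: F_def)
    then have "w (inv (fst p) \<otimes> fst q) \<le> 1" by (rule w_F)
    then have L2: "L p q \<le> 2 / N" using N by (auto simp: L_def divide_right_mono)
    have Nr: "0 < real N" using N by simp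
    have "\<lceil>N * \<rho> p q\<rceil> \<le> int (N * m)"
      using bound[OF pq] Nr by (simp add: ceiling_le_iff mult_left_mono)
    then have "real_of_int \<lceil>N * \<rho> p q\<rceil> \<le> N * m" by linarith
    then have \<rho>'m: "\<rho>' p q \<le> m" using Nr by (simp add: \<rho>'_def divide_le_eq mult.commute)
    have "\<rho>' p q - \<rho> p q = (real_of_int \<lceil>N * \<rho> p q\<rceil> - N * \<rho> p q) / N"
      using Nr by (simp add: \<rho>'_def diff_divide_distrib)
    moreover have "0 \<le> real_of_int \<lceil>N * \<rho> p q\<rceil> - N * \<rho> p q" "real_of_int \<lceil>N * \<rho> p q\<rceil> - N * \<rho> p q \<le> 1"
      by linarith+
    ultimately have 1: "0 \<le> \<rho>' p q - \<rho> p q" "\<rho>' p q - \<rho> p q \<le> 1 / N"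
      using Nr by (simp_all add: divide_right_mono)
    have 2: "\<bar>\<sigma> p q - \<rho>' p q\<bar> \<le> 2 / N"
      unfolding \<sigma>_def by (rule squeeze_near) (use L_nonneg L2 \<rho>'_nonneg[OF Z] \<rho>'m c' in auto)
    have "3 / real N = 2 / N + 1 / N" by (simp add: add_divide_distrib[symmetric])
    then show ?thesis using 1 2 by linarith
  qed
  moreover have "\<sigma> (\<one>, 0) (\<gamma>, 0) = c" if "\<gamma> \<in> carrier G - {g \<in> carrier G. w g < N * m}" for \<gamma>
  proof -
    have "w \<gamma> = N * m" using that w_le[of \<gamma>] by auto
    then have "L (\<one>, 0) (\<gamma>, 0) = m" using that N by (simp add: L_def)
    then show ?thesis unfolding \<sigma>_def using c' by (simp add: squeeze_far)
  qed
  ultimately show ?thesis using w_fin \<sigma>_le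
    by (intro exI[of _ "{g \<in> carrier G. w g < N * m}"] conjI exI[of _ \<sigma>] ballI)
qed

end

section \<open>Isometries of a dense subset of a complete space\<close>

locale dense_in_complete = Metric_space M d for M :: "'a set" and d +
  fixes Q
  assumes completion: "is_completion_of M d Q"
begin

lemma Q_sub: "Q \<subseteq> M" using completion by (simp add: is_completion_of_def)

lemma Q_in: "q \<in> Q \<Longrightarrow> q \<in> M" using Q_sub by blast

lemma dense:
  assumes "x \<in> M" "0 < r"
  shows "\<exists>q\<in>Q. d x q < r"
proof -
  have "x \<in> mtopology closure_of Q" using completion assms(1) by (simp add: is_completion_of_def)
  then show ?thesis using assms(2) by (fastforce simp: metric_closure_of)
qed

lemma isometric_eq_on_dense:
  assumes "\<And>x. x \<in> M \<Longrightarrow> a x \<in> M" "\<And>x. x \<in> M \<Longrightarrow> b x \<in> M"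
    and "isometric_on M d d a" "isometric_on M d d b" "\<And>q. q \<in> Q \<Longrightarrow> a q = b q" "x \<in> M"
  shows "a x = b x"
proof (rule ccontr)
  assume "a x \<noteq> b x"
  then have pos: "0 < d (a x) (b x)" using assms by simp
  obtain q where q: "q \<in> Q" "d x q < d (a x) (b x) / 2"
    using dense[OF assms(6), of "d (a x) (b x) / 2"] pos by auto
  have qM: "q \<in> M" using q Q_sub by blast
  have "d (a x) (a q) = d x q" "d (b x) (b q) = d x q"
    using assms(3,4,6) qM by (auto simp: isometric_on_def)
  then show False
    using q assms(5)[OF q(1)] triangle[of "a x" "a q" "b x"] commute[of "b x" "b q"] assms(1,2,6) qM by simp
qed

text \<open>The image of \<open>x\<close> is the point with distance \<open>d x q\<close> from \<open>b q\<close> for all \<open>q \<in> Q\<close>, found as the limit of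
  \<open>b\<close> along a sequence in \<open>Q\<close> converging to \<open>x\<close>.\<close>

lemma isometry_extends:
  assumes b: "\<And>q. q \<in> Q \<Longrightarrow> b q \<in> Q" and iso: "isometric_on Q d d b"
  shows "\<exists>\<beta>. (\<forall>x\<in>M. \<beta> x \<in> M) \<and> isometric_on M d d \<beta> \<and> (\<forall>q\<in>Q. \<beta> q = b q)"
proof -
  have b_iso: "d (b q) (b r) = d q r" if "q \<in> Q" "r \<in> Q" for q r
    using iso that by (simp add: isometric_on_def)
  have bM: "b q \<in> M" if "q \<in> Q" for q using b[OF that] Q_sub by blast
  have ex: "\<exists>y\<in>M. \<forall>q\<in>Q. d y (b q) = d x q" if x: "x \<in> M" for x
  proof -
    have "\<forall>n. \<exists>q\<in>Q. d x q < inverse (real (Suc n))" using dense[OF x] by simp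
    then obtain s where s: "\<And>n. s n \<in> Q" "\<And>n. d x (s n) < inverse (real (Suc n))" by metis
    have sM: "s n \<in> M" for n using s Q_sub by blast
    have "MCauchy (b \<circ> s)"
      unfolding MCauchy_def
    proof (intro conjI allI impI)
      show "range (b \<circ> s) \<subseteq> M" using bM s by auto
      fix \<epsilon> :: real assume "0 < \<epsilon>"
      then obtain N where N: "inverse (real (Suc N)) < \<epsilon> / 2" using reals_Archimedean[of "\<epsilon> / 2"] by auto
      have "d ((b \<circ> s) m) ((b \<circ> s) n) < \<epsilon>" if "N \<le> m" "N \<le> n" for m n
      proof -
        have "inverse (real (Suc k)) \<le> inverse (real (Suc N))" if "N \<le> k" for k
          using that by (simp add: le_imp_inverse_le)
        from this[OF that(1)] this[OF that(2)] have "d x (s m) < \<epsilon> / 2" "d x (s n) < \<epsilon> / 2"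
          using s(2)[of m] s(2)[of n] N by linarith+
        then show ?thesis
          using b_iso[OF s(1) s(1), of m n] triangle[OF sM x sM, of m n] commute[of "s m" x] by simp
      qed
      then show "\<exists>N. \<forall>n n'. N \<le> n \<longrightarrow> N \<le> n' \<longrightarrow> d ((b \<circ> s) n) ((b \<circ> s) n') < \<epsilon>" by blast
    qed
    then obtain y where lim: "limitin mtopology (b \<circ> s) y sequentially"
      using completion by (auto simp: is_completion_of_def mcomplete_def)
    then have y: "y \<in> M" by (simp add: limit_metric_sequentially)
    have "d y (b q) = d x q" if q: "q \<in> Q" for q
    proof -
      have "\<bar>d y (b q) - d x q\<bar> \<le> \<epsilon>" if eps: "0 < \<epsilon>" for \<epsilon>
      proof -
        obtain N where N: "\<And>n. n \<ge> N \<Longrightarrow> d ((b \<circ> s) n) y < \<epsilon> / 2"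
          using lim eps unfolding limit_metric_sequentially by (meson half_gt_zero)
        obtain K where K: "inverse (real (Suc K)) < \<epsilon> / 2" using reals_Archimedean[of "\<epsilon> / 2"] eps by auto
        define n where "n = max N K"
        have "inverse (real (Suc n)) \<le> inverse (real (Suc K))" by (simp add: n_def le_imp_inverse_le)
        then have 1: "d x (s n) < \<epsilon> / 2" using K s(2)[of n] by linarith
        have 2: "d (b (s n)) y < \<epsilon> / 2" using N[of n] by (simp add: n_def)
        show ?thesis
          using 1 2 b_iso[OF s(1) q, of n] mdist_reverse_triangle[of y "b q" "b (s n)"]
            mdist_reverse_triangle[of x q "s n"] y x sM[of n] bM[OF s(1)[of n]] bM[OF q] Q_in[OF q]
            commute[of "b (s n)" y] commute[of "b (s n)" "b q"] commute[of "s n" q]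
          by linarith
      qed
      then have "\<bar>d y (b q) - d x q\<bar> \<le> 0" using field_le_epsilon[of "\<bar>d y (b q) - d x q\<bar>" 0] by simp
      then show ?thesis by simp
    qed
    then show ?thesis using y by blast
  qed
  then obtain \<beta> where \<beta>: "\<And>x. x \<in> M \<Longrightarrow> \<beta> x \<in> M" "\<And>x q. x \<in> M \<Longrightarrow> q \<in> Q \<Longrightarrow> d (\<beta> x) (b q) = d x q"
    by metis
  have "d (\<beta> x) (\<beta> y) = d x y" if x: "x \<in> M" and y: "y \<in> M" for x y
  proof -
    have "\<bar>d (\<beta> x) (\<beta> y) - d x y\<bar> \<le> \<epsilon>" if "0 < \<epsilon>" for \<epsilon>
    proof -
      obtain q where q: "q \<in> Q" "d y q < \<epsilon> / 2" using dense[OF y, of "\<epsilon> / 2"] \<open>0 < \<epsilon>\<close> by auto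
      show ?thesis
        using q(2) \<beta>(2)[OF x q(1)] \<beta>(2)[OF y q(1)] x y \<beta>(1)[OF x] \<beta>(1)[OF y] bM[OF q(1)] Q_in[OF q(1)]
          mdist_reverse_triangle[of "\<beta> y" "\<beta> x" "b q"] mdist_reverse_triangle[of y x q]
          commute[of "\<beta> x" "\<beta> y"] commute[of x y]
        by linarith
    qed
    then have "\<bar>d (\<beta> x) (\<beta> y) - d x y\<bar> \<le> 0" using field_le_epsilon[of "\<bar>d (\<beta> x) (\<beta> y) - d x y\<bar>" 0] by simp
    then show ?thesis by simp
  qed
  moreover have "\<beta> q = b q" if q: "q \<in> Q" for q
  proof -
    have "d (\<beta> q) (b q) = d q q" using \<beta>(2)[OF _ q] Q_in[OF q] by blast
    then show ?thesis using Q_in[OF q] \<beta>(1)[OF Q_in[OF q]] bM[OF q] by simp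
  qed
  ultimately show ?thesis using \<beta>(1) by (intro exI[of _ \<beta>]) (auto simp: isometric_on_def)
qed

lemma action_extends:
  fixes \<Gamma> (structure)
  assumes "group \<Gamma>"
    and b: "\<And>g q. g \<in> carrier \<Gamma> \<Longrightarrow> q \<in> Q \<Longrightarrow> b g q \<in> Q"
    and iso: "\<And>g. g \<in> carrier \<Gamma> \<Longrightarrow> isometric_on Q d d (b g)"
    and mult: "\<And>g h q. g \<in> carrier \<Gamma> \<Longrightarrow> h \<in> carrier \<Gamma> \<Longrightarrow> q \<in> Q \<Longrightarrow> b (g \<otimes> h) q = b g (b h q)"
    and one: "\<And>q. q \<in> Q \<Longrightarrow> b \<one> q = q"
  shows "\<exists>\<pi>\<in>Rep \<Gamma> M d. \<forall>g\<in>carrier \<Gamma>. \<forall>q\<in>Q. \<pi> g q = b g q"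
proof -
  interpret \<Gamma>: group \<Gamma> by fact
  have "\<forall>g\<in>carrier \<Gamma>. \<exists>\<beta>. (\<forall>x\<in>M. \<beta> x \<in> M) \<and> isometric_on M d d \<beta> \<and> (\<forall>q\<in>Q. \<beta> q = b g q)"
    using isometry_extends[OF b iso] by simp
  then obtain \<beta> where \<beta>: "\<And>g x. g \<in> carrier \<Gamma> \<Longrightarrow> x \<in> M \<Longrightarrow> \<beta> g x \<in> M"
    "\<And>g. g \<in> carrier \<Gamma> \<Longrightarrow> isometric_on M d d (\<beta> g)"
    "\<And>g q. g \<in> carrier \<Gamma> \<Longrightarrow> q \<in> Q \<Longrightarrow> \<beta> g q = b g q" by metis
  have \<beta>_mult: "\<beta> (g \<otimes> h) x = \<beta> g (\<beta> h x)" if gh: "g \<in> carrier \<Gamma>" "h \<in> carrier \<Gamma>" and x: "x \<in> M" for g h x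
  proof (rule isometric_eq_on_dense[of "\<beta> (g \<otimes> h)" "\<lambda>x. \<beta> g (\<beta> h x)", OF _ _ _ _ _ x])
    show "isometric_on M d d (\<lambda>x. \<beta> g (\<beta> h x))"
      using \<beta>(1)[OF gh(2)] \<beta>(2)[OF gh(1)] \<beta>(2)[OF gh(2)] by (simp add: isometric_on_def)
    show "\<beta> (g \<otimes> h) q = \<beta> g (\<beta> h q)" if "q \<in> Q" for q
      using \<beta>(3) gh that mult b by simp
  qed (use \<beta> gh in auto)
  have \<beta>_one: "\<beta> \<one> x = x" if x: "x \<in> M" for x
    by (rule isometric_eq_on_dense[of "\<beta> \<one>" "\<lambda>x. x", OF _ _ _ _ _ x])
      (use \<beta> one in \<open>auto simp: isometric_on_def\<close>)
  define \<pi> where "\<pi> = (\<lambda>g\<in>carrier \<Gamma>. \<lambda>x\<in>M. \<beta> g x)"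
  have \<pi>: "\<pi> g x = \<beta> g x" if "g \<in> carrier \<Gamma>" "x \<in> M" for g x using that by (simp add: \<pi>_def)
  have \<pi>_Iso: "\<pi> g \<in> carrier (Iso M d)" if g: "g \<in> carrier \<Gamma>" for g
  proof -
    have "bij_betw (\<pi> g) M M"
    proof (rule bij_betw_byWitness[where f' = "\<beta> (inv g)"])
      show "\<forall>x\<in>M. \<beta> (inv g) (\<pi> g x) = x" using \<beta>_mult[of "inv g" g] \<beta>_one g \<pi> by simp
      show "\<forall>x\<in>M. \<pi> g (\<beta> (inv g) x) = x" using \<beta>_mult[of g "inv g"] \<beta>_one g \<pi> \<beta>(1) by simp
    qed (use \<beta>(1) g \<pi> in auto)
    moreover have "isometric_on M d d (\<pi> g)" using \<beta>(2)[OF g] \<pi>[OF g] by (simp add: isometric_on_def)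
    ultimately show ?thesis using g by (simp add: Iso_def Bij_def \<pi>_def)
  qed
  have "\<pi> \<in> hom \<Gamma> (Iso M d)"
  proof (rule homI)
    fix g h assume gh: "g \<in> carrier \<Gamma>" "h \<in> carrier \<Gamma>"
    have "\<pi> (g \<otimes> h) = compose M (\<pi> g) (\<pi> h)"
    proof
      fix x show "\<pi> (g \<otimes> h) x = compose M (\<pi> g) (\<pi> h) x"
        using gh \<beta>_mult[OF gh] \<beta>(1) by (simp add: \<pi>_def compose_def)
    qed
    moreover have "\<pi> g \<in> Bij M" "\<pi> h \<in> Bij M" using \<pi>_Iso gh by (auto simp: Iso_def)
    ultimately show "\<pi> (g \<otimes> h) = \<pi> g \<otimes>\<^bsub>Iso M d\<^esub> \<pi> h" by (simp add: Iso_def BijGroup_def)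
  qed (use \<pi>_Iso in auto)
  then have "\<pi> \<in> Rep \<Gamma> M d" by (simp add: Rep_def \<pi>_def)
  moreover have "\<pi> g q = b g q" if "g \<in> carrier \<Gamma>" "q \<in> Q" for g q
    using \<pi>[OF that(1) Q_in[OF that(2)]] \<beta>(3) that by simp
  ultimately show ?thesis by blast
qed

end

section \<open>The topology of the space of representations\<close>

lemma finite_positive_minimum:
  fixes r :: "'a \<Rightarrow> real"
  assumes "finite X" "\<And>x. x \<in> X \<Longrightarrow> 0 < r x"
  shows "\<exists>\<epsilon>>0. \<forall>x\<in>X. \<epsilon> \<le> r x"
  using assms by (intro exI[of _ "Min (insert 1 (r ` X))"]) (auto simp: Min_gr_iff)

lemma Iso_topology_nbhd:
  assumes M: "Metric_space M d" and W: "openin (Iso_topology M d) W" "a \<in> W"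
  shows "\<exists>X \<epsilon>. finite X \<and> X \<subseteq> M \<and> 0 < \<epsilon> \<and>
    (\<forall>b\<in>carrier (Iso M d). (\<forall>x\<in>X. d (b x) (a x) < \<epsilon>) \<longrightarrow> b \<in> W)"
proof -
  interpret Metric_space M d by fact
  obtain T where T: "openin (product_topology (\<lambda>_. mtopology) M) T" "W = T \<inter> carrier (Iso M d)"
    using W(1) by (auto simp: Iso_topology_def openin_subtopology)
  have "a \<in> T" using W(2) T(2) by blast
  then obtain U where U: "finite {x \<in> M. U x \<noteq> M}" "\<forall>x\<in>M. openin mtopology (U x)" "a \<in> Pi\<^sub>E M U" "Pi\<^sub>E M U \<subseteq> T"
    using T(1) unfolding openin_product_topology_alt topspace_mtopology by blast
  have "\<forall>x\<in>M. \<exists>r>0. mball (a x) r \<subseteq> U x"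
    using U(2,3) by (auto simp: openin_mtopology PiE_iff)
  then obtain r where r: "\<And>x. x \<in> M \<Longrightarrow> 0 < r x" "\<And>x. x \<in> M \<Longrightarrow> mball (a x) (r x) \<subseteq> U x" by metis
  define X where "X = {x \<in> M. U x \<noteq> M}"
  have "finite X" "\<And>x. x \<in> X \<Longrightarrow> 0 < r x" using U(1) r(1) by (auto simp: X_def)
  then obtain \<epsilon> where \<epsilon>: "0 < \<epsilon>" "\<forall>x\<in>X. \<epsilon> \<le> r x" using finite_positive_minimum by metis
  have Iso_in: "c x \<in> M" if "c \<in> carrier (Iso M d)" "x \<in> M" for c x
    using that bij_betw_apply by (fastforce simp: Iso_def Bij_def)
  have aI: "a \<in> carrier (Iso M d)" using W(2) T(2) by blast
  have "b \<in> W" if b: "b \<in> carrier (Iso M d)" "\<forall>x\<in>X. d (b x) (a x) < \<epsilon>" for b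
  proof -
    have "b x \<in> U x" if x: "x \<in> M" for x
    proof (cases "x \<in> X")
      case True
      then have "b x \<in> mball (a x) (r x)"
        using b(2) \<epsilon>(2) Iso_in[OF b(1) x] Iso_in[OF aI x] commute[of "a x" "b x"] by force
      then show ?thesis using r(2)[OF x] by blast
    next
      case False
      then show ?thesis using x Iso_in[OF b(1) x] by (simp add: X_def)
    qed
    moreover have "b \<in> extensional M" using b(1) by (auto simp: Iso_def Bij_def)
    ultimately have "b \<in> Pi\<^sub>E M U" by (simp add: PiE_iff)
    then show ?thesis using U(4) T(2) b(1) by blast
  qed
  then show ?thesis using \<open>finite X\<close> \<epsilon>(1) by (intro exI[of _ X] exI[of _ \<epsilon>]) (auto simp: X_def)
qed

lemma Rep_topology_nbhd:
  assumes M: "Metric_space M d" and V: "openin (Rep_topology \<Gamma> M d) V" "\<pi> \<in> V"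
  shows "\<exists>F X \<epsilon>. finite F \<and> F \<subseteq> carrier \<Gamma> \<and> finite X \<and> X \<subseteq> M \<and> 0 < \<epsilon> \<and>
    (\<forall>\<pi>'\<in>Rep \<Gamma> M d. (\<forall>f\<in>F. \<forall>x\<in>X. d (\<pi>' f x) (\<pi> f x) < \<epsilon>) \<longrightarrow> \<pi>' \<in> V)"
proof -
  obtain T where T: "openin (product_topology (\<lambda>_. Iso_topology M d) (carrier \<Gamma>)) T" "V = T \<inter> Rep \<Gamma> M d"
    using V(1) by (auto simp: Rep_topology_def openin_subtopology)
  have "\<pi> \<in> T" using V(2) T(2) by blast
  from T(1)[unfolded openin_product_topology_alt topspace_Iso_topology[OF M], THEN bspec, OF this]
  obtain U where U: "finite {g \<in> carrier \<Gamma>. U g \<noteq> carrier (Iso M d)}"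
    "\<forall>g\<in>carrier \<Gamma>. openin (Iso_topology M d) (U g)" "\<pi> \<in> Pi\<^sub>E (carrier \<Gamma>) U" "Pi\<^sub>E (carrier \<Gamma>) U \<subseteq> T"
    by (elim exE conjE)
  have "\<forall>g\<in>carrier \<Gamma>. \<exists>X. \<exists>\<epsilon>>0. finite X \<and> X \<subseteq> M \<and>
    (\<forall>b\<in>carrier (Iso M d). (\<forall>x\<in>X. d (b x) (\<pi> g x) < \<epsilon>) \<longrightarrow> b \<in> U g)"
  proof
    fix g assume g: "g \<in> carrier \<Gamma>"
    have "openin (Iso_topology M d) (U g)" "\<pi> g \<in> U g" using U(2) PiE_mem[OF U(3) g] g by auto
    from Iso_topology_nbhd[OF M this] show "\<exists>X. \<exists>\<epsilon>>0. finite X \<and> X \<subseteq> M \<and>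
      (\<forall>b\<in>carrier (Iso M d). (\<forall>x\<in>X. d (b x) (\<pi> g x) < \<epsilon>) \<longrightarrow> b \<in> U g)" by (elim exE conjE) (intro exI conjI)
  qed
  from bchoice[OF this] obtain X where "\<forall>g\<in>carrier \<Gamma>. \<exists>\<epsilon>. 0 < \<epsilon> \<and> finite (X g) \<and> X g \<subseteq> M \<and>
    (\<forall>b\<in>carrier (Iso M d). (\<forall>x\<in>X g. d (b x) (\<pi> g x) < \<epsilon>) \<longrightarrow> b \<in> U g)" ..
  from bchoice[OF this] obtain \<epsilon> where *: "\<forall>g\<in>carrier \<Gamma>. 0 < \<epsilon> g \<and> finite (X g) \<and> X g \<subseteq> M \<and>
    (\<forall>b\<in>carrier (Iso M d). (\<forall>x\<in>X g. d (b x) (\<pi> g x) < \<epsilon> g) \<longrightarrow> b \<in> U g)" ..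
  then have X: "finite (X g)" "X g \<subseteq> M" "0 < \<epsilon> g" if "g \<in> carrier \<Gamma>" for g using that by auto
  have X_nbhd: "b \<in> U g" if "g \<in> carrier \<Gamma>" "b \<in> carrier (Iso M d)" "\<forall>x\<in>X g. d (b x) (\<pi> g x) < \<epsilon> g" for g b
    using * that by blast
  define F where "F = {g \<in> carrier \<Gamma>. U g \<noteq> carrier (Iso M d)}"
  have "finite F" "\<And>g. g \<in> F \<Longrightarrow> 0 < \<epsilon> g" using U(1) X(3) by (auto simp: F_def)
  then obtain e where e: "0 < e" "\<forall>g\<in>F. e \<le> \<epsilon> g" using finite_positive_minimum by metis
  have "\<pi>' \<in> V" if \<pi>': "\<pi>' \<in> Rep \<Gamma> M d" "\<forall>f\<in>F. \<forall>x\<in>(\<Union>g\<in>F. X g). d (\<pi>' f x) (\<pi> f x) < e" for \<pi>'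
  proof -
    have I: "\<pi>' g \<in> carrier (Iso M d)" if "g \<in> carrier \<Gamma>" for g
      using \<pi>'(1) that by (auto simp: Rep_def hom_def)
    have "\<pi>' g \<in> U g" if g: "g \<in> carrier \<Gamma>" for g
    proof (cases "g \<in> F")
      case True
      then have "\<forall>x\<in>X g. d (\<pi>' g x) (\<pi> g x) < \<epsilon> g" using \<pi>'(2) e(2) by force
      then show ?thesis by (rule X_nbhd[OF g I[OF g]])
    next
      case False
      then show ?thesis using g I[OF g] by (simp add: F_def)
    qed
    then have "\<pi>' \<in> Pi\<^sub>E (carrier \<Gamma>) U" using \<pi>'(1) by (simp add: PiE_iff Rep_def)
    then show ?thesis using U(4) T(2) \<pi>'(1) by blast
  qed
  moreover have "finite (\<Union>g\<in>F. X g)" "(\<Union>g\<in>F. X g) \<subseteq> M" "F \<subseteq> carrier \<Gamma>"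
    using \<open>finite F\<close> X(1,2) by (auto simp: F_def)
  ultimately show ?thesis using \<open>finite F\<close> e(1)
    by (intro exI[of _ F] exI[of _ "\<Union>g\<in>F. X g"] exI[of _ e] conjI ballI impI)
qed

lemma continuous_displacement:
  assumes M: "Metric_space M d" and g: "\<gamma> \<in> carrier \<Gamma>" and x: "x \<in> M"
  shows "continuous_map (Rep_topology \<Gamma> M d) euclideanreal (\<lambda>\<pi>. d (\<pi> \<gamma> x) x)"
proof -
  interpret Metric_space M d by fact
  have "continuous_map (Rep_topology \<Gamma> M d) (Iso_topology M d) (\<lambda>\<pi>. \<pi> \<gamma>)"
    unfolding Rep_topology_def
    by (intro continuous_map_from_subtopology continuous_map_product_projection g)
  moreover have "continuous_map (Iso_topology M d) mtopology (\<lambda>a. a x)"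
    unfolding Iso_topology_def
    by (intro continuous_map_from_subtopology continuous_map_product_projection x)
  ultimately have "continuous_map (Rep_topology \<Gamma> M d) mtopology ((\<lambda>a. a x) \<circ> (\<lambda>\<pi>. \<pi> \<gamma>))"
    by (rule continuous_map_compose)
  then have "continuous_map (Rep_topology \<Gamma> M d) mtopology (\<lambda>\<pi>. \<pi> \<gamma> x)" by (simp add: o_def)
  then show ?thesis
    using continuous_map_mdist[of "Rep_topology \<Gamma> M d" "metric (M, d)" "\<lambda>\<pi>. \<pi> \<gamma> x" "\<lambda>_. x"] x by simp
qed

text \<open>The condition \<open>d (\<pi> \<gamma> x) x \<in> T \<gamma>\<close> is open, so the set in question is closed and it is enough to
  find, in every nonempty open set, one representation outside it.\<close>

lemma nowhere_dense_displacement: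
  assumes M: "Metric_space M d" and A: "A \<subseteq> carrier \<Gamma>" and x: "x \<in> M"
    and O: "\<And>\<gamma>. \<gamma> \<in> A \<Longrightarrow> open (T \<gamma>)"
    and dense: "\<And>V \<pi>. openin (Rep_topology \<Gamma> M d) V \<Longrightarrow> \<pi> \<in> V \<Longrightarrow> \<exists>\<gamma>\<in>A. \<exists>\<pi>'\<in>V. d (\<pi>' \<gamma> x) x \<in> T \<gamma>"
  shows "nowhere_dense_in (Rep_topology \<Gamma> M d) {\<pi> \<in> Rep \<Gamma> M d. \<forall>\<gamma>\<in>A. d (\<pi> \<gamma> x) x \<notin> T \<gamma>}"
    (is "nowhere_dense_in ?R ?N")
proof -
  have "?R interior_of (?R closure_of ?N) = {}"
  proof (rule ccontr)
    define V where "V = ?R interior_of (?R closure_of ?N)"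
    assume "?R interior_of (?R closure_of ?N) \<noteq> {}"
    then obtain \<pi> where "\<pi> \<in> V" by (auto simp: V_def)
    moreover have V: "openin ?R V" "V \<subseteq> ?R closure_of ?N" by (simp_all add: V_def interior_of_subset)
    ultimately obtain \<gamma> \<pi>' where \<gamma>: "\<gamma> \<in> A" "\<pi>' \<in> V" "d (\<pi>' \<gamma> x) x \<in> T \<gamma>" using dense by blast
    let ?W = "{\<rho> \<in> topspace ?R. d (\<rho> \<gamma> x) x \<in> T \<gamma>}"
    have W: "openin ?R ?W"
      using openin_continuous_map_preimage[OF continuous_displacement[OF M _ x, of \<gamma> \<Gamma>], of "T \<gamma>"] A \<gamma>(1) O
      by auto
    have \<pi>'W: "\<pi>' \<in> ?W" using \<gamma> openin_subset[OF V(1)] by blast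
    have "\<forall>W. \<pi>' \<in> W \<and> openin ?R W \<longrightarrow> (\<exists>\<rho>. \<rho> \<in> ?N \<and> \<rho> \<in> W)"
      using \<gamma>(2) V(2) by (auto simp: in_closure_of)
    from this[THEN spec, THEN mp, OF conjI[OF \<pi>'W W]] obtain \<rho> where "\<rho> \<in> ?N" "\<rho> \<in> ?W"
      by (elim exE conjE)
    then show False using \<gamma>(1) by auto
  qed
  then show ?thesis by (auto simp: nowhere_dense_in_def topspace_Rep_topology[OF M])
qed

lemma meager_in_countable_cover:
  assumes "countable I" "\<And>i. i \<in> I \<Longrightarrow> nowhere_dense_in T (N i)" "C \<subseteq> (\<Union>i\<in>I. N i)"
  shows "meager_in T C"
  unfolding meager_in_def
proof (intro exI conjI ballI)
  show "countable ((\<lambda>i. C \<inter> N i) ` I)" using assms(1) by simp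
  fix K assume "K \<in> (\<lambda>i. C \<inter> N i) ` I"
  then obtain i where i: "i \<in> I" "K = C \<inter> N i" by blast
  have "T closure_of K \<subseteq> T closure_of N i" using i by (intro closure_of_mono) auto
  then have "T interior_of (T closure_of K) \<subseteq> T interior_of (T closure_of N i)" by (rule interior_of_mono)
  then show "nowhere_dense_in T K" using assms(2)[OF i(1)] i(2) by (auto simp: nowhere_dense_in_def)
qed (use assms(3) in auto)

section \<open>Representations with prescribed displacement are dense\<close>

text \<open>What the Urysohn space (\<open>D = \<rat>\<close>) and the Urysohn sphere (\<open>D = \<rat> \<inter> {0..1}\<close>) have in common.\<close>

locale rational_completion = dense_in_complete M d Q for M :: "'a set" and d Q +
  fixes D
  assumes scale: "distance_scale D" and countable_Q: "countable Q"
    and metric_Q: "metric_over D Q d" and extensions_Q: "has_extensions D Q d"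
begin

text \<open>A free action with distances \<open>\<sigma>\<close> that nearly agree, on a finite set \<open>P\<close>, with those of points \<open>v p\<close> of
  \<open>M\<close> is found inside \<open>M\<close>, as part of a representation, with the points of \<open>P\<close> close to their models.\<close>

lemma realize_free_action:
  fixes \<Gamma> (structure) and k :: nat and v :: "'g \<times> nat \<Rightarrow> 'a"
  assumes "group \<Gamma>" and cnt: "countable (carrier \<Gamma>)" and k: "0 < k"
    and \<sigma>: "metric_over D (carrier \<Gamma> \<times> {..<k}) \<sigma>" "shift_invariant \<Gamma> {..<k} \<sigma>"
    and B: "B \<in> D" "\<And>p q. p \<in> carrier \<Gamma> \<times> {..<k} \<Longrightarrow> q \<in> carrier \<Gamma> \<times> {..<k} \<Longrightarrow> \<sigma> p q \<le> B"
    and P: "finite P" "P \<subseteq> carrier \<Gamma> \<times> {..<k}" "\<And>p. p \<in> P \<Longrightarrow> v p \<in> M"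
    and \<epsilon>: "0 < \<epsilon>" "\<And>p q. p \<in> P \<Longrightarrow> q \<in> P \<Longrightarrow> \<bar>\<sigma> p q - d (v p) (v q)\<bar> \<le> \<epsilon>"
  shows "\<exists>\<pi>\<in>Rep \<Gamma> M d. \<exists>y. (\<forall>p\<in>carrier \<Gamma> \<times> {..<k}. y p \<in> M) \<and>
    (\<forall>g\<in>carrier \<Gamma>. \<forall>p\<in>carrier \<Gamma> \<times> {..<k}. \<pi> g (y p) = y (shift \<Gamma> g p)) \<and>
    (\<forall>p\<in>carrier \<Gamma> \<times> {..<k}. \<forall>q\<in>carrier \<Gamma> \<times> {..<k}. d (y p) (y q) = \<sigma> p q) \<and>
    (\<forall>p\<in>P. d (y p) (v p) \<le> real (card P + 1) * (2 * \<epsilon>))"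
proof -
  interpret \<Gamma>: group \<Gamma> by fact
  let ?Z = "carrier \<Gamma> \<times> (UNIV :: nat set)" and ?Zk = "carrier \<Gamma> \<times> {..<k}"
  have "\<exists>S. metric_over D ?Z S \<and> shift_invariant \<Gamma> UNIV S \<and> has_extensions D ?Z S \<and>
    (\<forall>p\<in>?Zk. \<forall>q\<in>?Zk. S p q = \<sigma> p q)"
    by (rule \<Gamma>.free_action_with_extensions[OF scale cnt k \<sigma> B(1)]) (rule B(2))
  then obtain S where S: "metric_over D ?Z S" "shift_invariant \<Gamma> UNIV S" "has_extensions D ?Z S"
    "\<forall>p\<in>?Zk. \<forall>q\<in>?Zk. S p q = \<sigma> p q" by (elim exE conjE)
  have "\<forall>p\<in>P. \<exists>q\<in>Q. d (v p) q < \<epsilon> / 2" using dense[OF P(3), of _ "\<epsilon> / 2"] \<epsilon>(1) by simp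
  then obtain q where q: "\<And>p. p \<in> P \<Longrightarrow> q p \<in> Q" "\<And>p. p \<in> P \<Longrightarrow> d (v p) (q p) < \<epsilon> / 2" by metis
  have qM: "q p \<in> M" if "p \<in> P" for p using q(1)[OF that] Q_in by blast
  have near: "\<bar>S p r - d (q p) (q r)\<bar> \<le> 2 * \<epsilon>" if pr: "p \<in> P" "r \<in> P" for p r
  proof -
    have "p \<in> ?Zk" "r \<in> ?Zk" using pr P(2) by auto
    then have "S p r = \<sigma> p r" using S(4) by blast
    then show ?thesis
      using \<epsilon>(2)[OF pr] q(2)[OF pr(1)] q(2)[OF pr(2)] P(3)[OF pr(1)] P(3)[OF pr(2)] qM[OF pr(1)] qM[OF pr(2)]
        triangle[of "q p" "v p" "q r"] triangle[of "v p" "v r" "q r"] triangle[of "v p" "q p" "v r"]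
        triangle[of "q p" "q r" "v r"] commute[of "q p" "v p"] commute[of "q r" "v r"]
      by linarith
  qed
  have PZ: "P \<subseteq> ?Z" using P(2) by auto
  have "0 \<le> 2 * \<epsilon>" using \<epsilon>(1) by simp
  then have "\<exists>R. finite R \<and> R \<subseteq> ?Z \<times> Q \<and> partial_isometry S d R \<and>
    (\<forall>p\<in>P. \<exists>y. (p, y) \<in> R \<and> d y (q p) \<le> real (card P) * (2 * \<epsilon>))"
    by (intro nearly_isometric_copy[OF scale S(1) metric_Q extensions_Q P(1) PZ] q(1) near)
  then obtain R where R: "finite R" "R \<subseteq> ?Z \<times> Q" "partial_isometry S d R"
    and R_near: "\<forall>p\<in>P. \<exists>y. (p, y) \<in> R \<and> d y (q p) \<le> real (card P) * (2 * \<epsilon>)" by (elim exE conjE)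
  have "countable ?Z" using cnt by (intro countable_SIGMA) auto
  from back_and_forth[OF scale S(1) metric_Q S(3) extensions_Q this countable_Q R]
  obtain \<phi> where \<phi>: "bij_betw \<phi> ?Z Q" "\<forall>x\<in>?Z. \<forall>y\<in>?Z. d (\<phi> x) (\<phi> y) = S x y" "\<forall>(a, b)\<in>R. \<phi> a = b"
    by (elim exE conjE)
  have \<phi>Q: "\<phi> p \<in> Q" if "p \<in> ?Z" for p using bij_betw_apply[OF \<phi>(1) that] .
  define \<psi> where "\<psi> = inv_into ?Z \<phi>"
  have \<psi>\<phi>: "\<psi> (\<phi> p) = p" if "p \<in> ?Z" for p
    unfolding \<psi>_def using \<phi>(1) that by (intro inv_into_f_f) (auto simp: bij_betw_def)
  have \<psi>: "\<psi> z \<in> ?Z" "\<phi> (\<psi> z) = z" if "z \<in> Q" for z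
    using bij_betw_inv_into_right[OF \<phi>(1) that] bij_betw_apply[OF bij_betw_inv_into[OF \<phi>(1)] that]
    by (simp_all add: \<psi>_def)
  \<comment> \<open>The shift action, transported to \<open>Q\<close>.\<close>
  define b where "b g z = \<phi> (shift \<Gamma> g (\<psi> z))" for g z
  have sh: "shift \<Gamma> g p \<in> ?Z" if "g \<in> carrier \<Gamma>" "p \<in> ?Z" for g p using \<Gamma>.shift_in[OF that] .
  have "\<exists>\<pi>\<in>Rep \<Gamma> M d. \<forall>g\<in>carrier \<Gamma>. \<forall>z\<in>Q. \<pi> g z = b g z"
  proof (rule action_extends)
    show "b g z \<in> Q" if "g \<in> carrier \<Gamma>" "z \<in> Q" for g z
      unfolding b_def using \<phi>Q sh \<psi>(1) that by blast
    show "isometric_on Q d d (b g)" if g: "g \<in> carrier \<Gamma>" for g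
      unfolding isometric_on_def
    proof (intro ballI)
      fix z z' assume z: "z \<in> Q" "z' \<in> Q"
      have "d (b g z) (b g z') = S (shift \<Gamma> g (\<psi> z)) (shift \<Gamma> g (\<psi> z'))"
        unfolding b_def using \<phi>(2) sh[OF g \<psi>(1)] z by blast
      also have "\<dots> = S (\<psi> z) (\<psi> z')" by (rule shift_invariantD[OF S(2) g \<psi>(1) \<psi>(1)]) (fact z)+
      also have "\<dots> = d (\<phi> (\<psi> z)) (\<phi> (\<psi> z'))" using \<phi>(2) \<psi>(1) z by metis
      finally show "d (b g z) (b g z') = d z z'" using \<psi>(2) z by simp
    qed
    show "b (g \<otimes> h) z = b g (b h z)" if g: "g \<in> carrier \<Gamma>" and h: "h \<in> carrier \<Gamma>" and z: "z \<in> Q" for g h z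
      unfolding b_def \<psi>\<phi>[OF sh[OF h \<psi>(1)[OF z]]] \<Gamma>.shift_mult[OF g h \<psi>(1)[OF z]] ..
    show "b \<one> z = z" if "z \<in> Q" for z
      unfolding b_def \<Gamma>.shift_one[OF \<psi>(1)[OF that]] by (rule \<psi>(2)[OF that])
  qed fact
  then obtain \<pi> where \<pi>: "\<pi> \<in> Rep \<Gamma> M d" "\<forall>g\<in>carrier \<Gamma>. \<forall>z\<in>Q. \<pi> g z = b g z" ..
  have kZ: "p \<in> ?Z" if "p \<in> ?Zk" for p using that by auto
  have "\<phi> p \<in> M" if "p \<in> ?Zk" for p using Q_in[OF \<phi>Q[OF kZ[OF that]]] .
  moreover have "\<pi> g (\<phi> p) = \<phi> (shift \<Gamma> g p)" if "g \<in> carrier \<Gamma>" "p \<in> ?Zk" for g p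
    using \<pi>(2)[rule_format, OF that(1) \<phi>Q[OF kZ[OF that(2)]]] \<psi>\<phi>[OF kZ[OF that(2)]] by (simp add: b_def)
  moreover have "d (\<phi> p) (\<phi> r) = \<sigma> p r" if "p \<in> ?Zk" "r \<in> ?Zk" for p r
    using \<phi>(2)[rule_format, OF kZ[OF that(1)] kZ[OF that(2)]] S(4)[rule_format, OF that] by simp
  moreover have "d (\<phi> p) (v p) \<le> real (card P + 1) * (2 * \<epsilon>)" if p: "p \<in> P" for p
  proof -
    obtain y where y: "(p, y) \<in> R" "d y (q p) \<le> real (card P) * (2 * \<epsilon>)" using R_near p by blast
    have "\<phi> p = y" using bspec[OF \<phi>(3) y(1)] by simp
    moreover have "y \<in> M" using y(1) R(2) Q_in by blast
    moreover have "real (card P + 1) * (2 * \<epsilon>) = real (card P) * (2 * \<epsilon>) + 2 * \<epsilon>" by (simp add: algebra_simps)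
    ultimately show ?thesis
      using y(2) triangle[of y "q p" "v p"] q(2)[OF p] qM[OF p] P(3)[OF p] commute[of "q p" "v p"] \<epsilon>(1)
      by simp
  qed
  ultimately show ?thesis using \<pi>(1) by (intro bexI[of _ \<pi>] exI[of _ \<phi>] conjI ballI)
qed

lemma Rep_in:
  assumes "\<pi> \<in> Rep \<Gamma> M d" "g \<in> carrier \<Gamma>" "x \<in> M"
  shows "\<pi> g x \<in> M"
proof -
  have "bij_betw (\<pi> g) M M" using assms(1,2) by (auto simp: Rep_def hom_def Iso_def Bij_def)
  then show ?thesis using assms(3) by (rule bij_betw_apply)
qed

lemma Rep_isometric:
  "\<pi> \<in> Rep \<Gamma> M d \<Longrightarrow> g \<in> carrier \<Gamma> \<Longrightarrow> x \<in> M \<Longrightarrow> y \<in> M \<Longrightarrow> d (\<pi> g x) (\<pi> g y) = d x y"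
  by (auto simp: Rep_def hom_def Iso_def isometric_on_def)

lemma Rep_mult:
  assumes "\<pi> \<in> Rep \<Gamma> M d" "g \<in> carrier \<Gamma>" "h \<in> carrier \<Gamma>" "x \<in> M"
  shows "\<pi> (g \<otimes>\<^bsub>\<Gamma>\<^esub> h) x = \<pi> g (\<pi> h x)"
proof -
  have "\<pi> g \<in> Bij M" "\<pi> h \<in> Bij M" "\<pi> (g \<otimes>\<^bsub>\<Gamma>\<^esub> h) = \<pi> g \<otimes>\<^bsub>Iso M d\<^esub> \<pi> h"
    using assms by (auto simp: Rep_def hom_def Iso_def)
  then show ?thesis using assms(4) by (simp add: Iso_def BijGroup_def compose_def)
qed

lemma Rep_one:
  assumes "group \<Gamma>" "\<pi> \<in> Rep \<Gamma> M d" "x \<in> M"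
  shows "\<pi> \<one>\<^bsub>\<Gamma>\<^esub> x = x"
proof -
  interpret group \<Gamma> by fact
  have "d (\<pi> \<one>\<^bsub>\<Gamma>\<^esub> (\<pi> \<one>\<^bsub>\<Gamma>\<^esub> x)) (\<pi> \<one>\<^bsub>\<Gamma>\<^esub> x) = d (\<pi> \<one>\<^bsub>\<Gamma>\<^esub> x) x"
    using Rep_isometric[OF assms(2)] Rep_in[OF assms(2)] assms(3) by simp
  moreover have "\<pi> \<one>\<^bsub>\<Gamma>\<^esub> (\<pi> \<one>\<^bsub>\<Gamma>\<^esub> x) = \<pi> \<one>\<^bsub>\<Gamma>\<^esub> x"
    using Rep_mult[OF assms(2) one_closed one_closed assms(3)] by simp
  ultimately show ?thesis using Rep_in[OF assms(2) one_closed assms(3)] assms(3) by simp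
qed

text \<open>Here \<open>P\<close> consists of the images of finitely many points under finitely many group elements that
  determine a neighbourhood of \<open>\<pi>\<close>, and \<open>m\<close> has to bound the diameter of \<open>P\<close>. The order of the quantifiers
  matters: \<open>m\<close> depends on \<open>V\<close>, and the finite set \<open>E\<close> of exceptions on \<open>m\<close>.\<close>

lemma displacement_dense:
  fixes \<Gamma> (structure)
  assumes "group \<Gamma>" and cnt: "countable (carrier \<Gamma>)"
    and V: "openin (Rep_topology \<Gamma> M d) V" "\<pi> \<in> V" and x: "x \<in> M"
  shows "\<exists>P. finite P \<and> P \<subseteq> M \<and> (\<forall>m :: nat. 0 < m \<longrightarrow> real m \<in> D \<longrightarrow> (\<forall>y\<in>P. \<forall>z\<in>P. d y z \<le> m) \<longrightarrow>
    (\<forall>c \<epsilon> :: real. (c = real m \<or> c = real m / 2) \<longrightarrow> 0 < \<epsilon> \<longrightarrow>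
      (\<exists>E. finite E \<and> (\<forall>\<gamma>\<in>carrier \<Gamma> - E. \<exists>\<pi>'\<in>V. \<bar>d (\<pi>' \<gamma> x) x - c\<bar> < \<epsilon>))))"
proof -
  interpret \<Gamma>: group \<Gamma> by fact
  have MS: "Metric_space M d" by unfold_locales
  have \<pi>: "\<pi> \<in> Rep \<Gamma> M d" using openin_subset[OF V(1)] V(2) topspace_Rep_topology[OF MS] by blast
  obtain F X \<epsilon>0 where F: "finite F" "F \<subseteq> carrier \<Gamma>" and X: "finite X" "X \<subseteq> M" and \<epsilon>0: "0 < \<epsilon>0"
    and nbhd: "\<forall>\<pi>'\<in>Rep \<Gamma> M d. (\<forall>f\<in>F. \<forall>x\<in>X. d (\<pi>' f x) (\<pi> f x) < \<epsilon>0) \<longrightarrow> \<pi>' \<in> V"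
    using Rep_topology_nbhd[OF MS V] by (elim exE conjE)
  obtain xs where xs: "set xs = X" using finite_list[OF X(1)] by blast
  define k where "k = Suc (length xs)"
  define pt where "pt i = (x # xs) ! i" for i
  have pt0: "pt 0 = x" and k: "0 < k" by (simp_all add: pt_def k_def)
  have pt_X: "\<exists>i<k. z = pt i" if "z \<in> X" for z
  proof -
    have "z \<in> set (x # xs)" using that xs by simp
    then obtain i where "i < length (x # xs)" "(x # xs) ! i = z" unfolding in_set_conv_nth by blast
    then show ?thesis by (auto simp: pt_def k_def)
  qed
  have ptM: "pt i \<in> M" if "i < k" for i
  proof -
    have "pt i \<in> set (x # xs)" unfolding pt_def by (rule nth_mem) (use that in \<open>simp add: k_def\<close>)
    then show ?thesis using xs X x by auto
  qed
  define H where "H = insert \<one> F"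
  have H: "finite H" "H \<subseteq> carrier \<Gamma>" using F by (auto simp: H_def)
  define v where "v p = \<pi> (fst p) (pt (snd p))" for p
  define \<rho> where "\<rho> p q = d (v p) (v q)" for p q
  let ?Z = "carrier \<Gamma> \<times> {..<k}" and ?P = "H \<times> {..<k}"
  have vM: "v p \<in> M" if "p \<in> ?Z" for p unfolding v_def using that ptM by (intro Rep_in[OF \<pi>]) auto
  have PZ: "?P \<subseteq> ?Z" and P_fin: "finite ?P" using H by auto
  have v_shift: "v (shift \<Gamma> g p) = \<pi> g (v p)" if "g \<in> carrier \<Gamma>" "p \<in> ?Z" for g p
  proof -
    have "fst p \<in> carrier \<Gamma>" "pt (snd p) \<in> M" using that ptM by auto
    then show ?thesis unfolding v_def using Rep_mult[OF \<pi> that(1)] by (simp add: shift_def)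
  qed
  have \<rho>_inv: "shift_invariant \<Gamma> {..<k} \<rho>"
    unfolding shift_invariant_def \<rho>_def using v_shift Rep_isometric[OF \<pi>] vM by simp
  show ?thesis
  proof (intro exI[of _ "v ` ?P"] conjI allI impI)
    show "finite (v ` ?P)" using P_fin by blast
    show "v ` ?P \<subseteq> M" using vM PZ by blast
    fix m :: nat and c \<epsilon> :: real
    assume m: "0 < m" "real m \<in> D" and bound: "\<forall>y\<in>v ` ?P. \<forall>z\<in>v ` ?P. d y z \<le> m"
      and c: "c = real m \<or> c = real m / 2" and \<epsilon>: "0 < \<epsilon>"
    define \<delta> where "\<delta> = min \<epsilon>0 \<epsilon>"
    have \<delta>: "0 < \<delta>" using \<epsilon> \<epsilon>0 by (simp add: \<delta>_def)
    \<comment> \<open>The factor 12 is the product of the error 3 of \<open>perturbed_metric\<close>, the 2 of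
      \<open>realize_free_action\<close>, and the 2 from comparing displacements at two points.\<close>
    obtain N where N: "12 * real (card ?P + 1) / \<delta> < real N" using reals_Archimedean2 by blast
    have "0 < 12 * real (card ?P + 1) / \<delta>" using \<delta> by simp
    then have N0: "0 < real N" using N by linarith
    \<comment> \<open>A bound for the distances between the new points \<open>y p\<close> and the old points \<open>v p\<close>.\<close>
    define \<eta> where "\<eta> = real (card ?P + 1) * (2 * (3 / real N))"
    have \<eta>: "2 * \<eta> < \<delta>"
    proof -
      have "12 * real (card ?P + 1) < real N * \<delta>" using N \<delta> by (simp add: divide_less_eq)
      then have "12 * real (card ?P + 1) / real N < \<delta>" using N0 by (simp add: divide_less_eq mult.commute)
      moreover have "2 * \<eta> = 12 * real (card ?P + 1) / real N" by (simp add: \<eta>_def)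
      ultimately show ?thesis by simp
    qed
    have "\<exists>E. finite E \<and> (\<exists>\<sigma>. metric_over D ?Z \<sigma> \<and> shift_invariant \<Gamma> {..<k} \<sigma> \<and>
      (\<forall>p\<in>?Z. \<forall>q\<in>?Z. \<sigma> p q \<le> real m) \<and> (\<forall>p\<in>?P. \<forall>q\<in>?P. \<bar>\<sigma> p q - \<rho> p q\<bar> \<le> 3 / N) \<and>
      (\<forall>\<gamma>\<in>carrier \<Gamma> - E. \<sigma> (\<one>, 0) (\<gamma>, 0) = c))"
    proof (rule \<Gamma>.perturbed_metric[OF scale H _ k m c _ _ _ _ \<rho>_inv])
      show "0 < N" using N0 by simp
      show "\<rho> p r \<le> \<rho> p q + \<rho> q r" if "p \<in> ?Z" "q \<in> ?Z" "r \<in> ?Z" for p q r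
        unfolding \<rho>_def using triangle vM that by blast
      show "\<rho> p p = 0" if "p \<in> ?Z" for p unfolding \<rho>_def using vM[OF that] by simp
      show "\<rho> p q \<le> m" if "p \<in> ?P" "q \<in> ?P" for p q unfolding \<rho>_def using bound that by blast
    qed (auto simp: \<rho>_def commute)
    then obtain E \<sigma> where E: "finite E" and \<sigma>: "metric_over D ?Z \<sigma>" "shift_invariant \<Gamma> {..<k} \<sigma>"
      "\<forall>p\<in>?Z. \<forall>q\<in>?Z. \<sigma> p q \<le> real m" "\<forall>p\<in>?P. \<forall>q\<in>?P. \<bar>\<sigma> p q - \<rho> p q\<bar> \<le> 3 / N"
      "\<forall>\<gamma>\<in>carrier \<Gamma> - E. \<sigma> (\<one>, 0) (\<gamma>, 0) = c" by (elim exE conjE)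
    have "\<exists>\<pi>'\<in>Rep \<Gamma> M d. \<exists>y. (\<forall>p\<in>?Z. y p \<in> M) \<and>
      (\<forall>g\<in>carrier \<Gamma>. \<forall>p\<in>?Z. \<pi>' g (y p) = y (shift \<Gamma> g p)) \<and>
      (\<forall>p\<in>?Z. \<forall>q\<in>?Z. d (y p) (y q) = \<sigma> p q) \<and>
      (\<forall>p\<in>?P. d (y p) (v p) \<le> real (card ?P + 1) * (2 * (3 / real N)))"
    proof (rule realize_free_action[OF assms(1) cnt k \<sigma>(1,2) m(2) _ P_fin PZ])
      show "\<bar>\<sigma> p q - d (v p) (v q)\<bar> \<le> 3 / real N" if "p \<in> ?P" "q \<in> ?P" for p q
        using \<sigma>(4) that unfolding \<rho>_def by blast
    qed (use \<sigma>(3) vM PZ N0 in auto)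
    then obtain \<pi>' y where \<pi>': "\<pi>' \<in> Rep \<Gamma> M d" and yM: "\<forall>p\<in>?Z. y p \<in> M"
      and y_shift: "\<forall>g\<in>carrier \<Gamma>. \<forall>p\<in>?Z. \<pi>' g (y p) = y (shift \<Gamma> g p)"
      and y_dist: "\<forall>p\<in>?Z. \<forall>q\<in>?Z. d (y p) (y q) = \<sigma> p q"
      and y_near: "\<forall>p\<in>?P. d (y p) (v p) \<le> \<eta>" unfolding \<eta>_def by (elim bexE exE conjE)
    have base: "(\<one>, i) \<in> ?P" "(\<one>, i) \<in> ?Z" "d (y (\<one>, i)) (pt i) \<le> \<eta>" "y (\<one>, i) \<in> M" if "i < k" for i
    proof -
      show 1: "(\<one>, i) \<in> ?P" "(\<one>, i) \<in> ?Z" using that by (auto simp: H_def)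
      have "v (\<one>, i) = pt i" using Rep_one[OF assms(1) \<pi> ptM[OF that]] by (simp add: v_def)
      then show "d (y (\<one>, i)) (pt i) \<le> \<eta>" using y_near 1(1) by metis
      show "y (\<one>, i) \<in> M" using yM 1(2) by blast
    qed
    have y_orbit: "\<pi>' g (y (\<one>, i)) = y (g, i)" if "g \<in> carrier \<Gamma>" "i < k" for g i
      using y_shift[rule_format, OF that(1) base(2)[OF that(2)]] that(1) by (simp add: shift_def)
    have "d (\<pi>' f z) (\<pi> f z) < \<epsilon>0" if f: "f \<in> F" and z: "z \<in> X" for f z
    proof -
      obtain i where i: "i < k" "z = pt i" using pt_X[OF z] by blast
      have fG: "f \<in> carrier \<Gamma>" and fP: "(f, i) \<in> ?P" and fZ: "(f, i) \<in> ?Z" using f F i by (auto simp: H_def)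
      have "d (\<pi>' f z) (y (f, i)) \<le> \<eta>"
        using Rep_isometric[OF \<pi>' fG ptM[OF i(1)] base(4)[OF i(1)]] base(3)[OF i(1)] y_orbit[OF fG i(1)] i(2)
          commute[of "pt i" "y (\<one>, i)"] by simp
      moreover have "d (y (f, i)) (\<pi> f z) \<le> \<eta>" using y_near[rule_format, OF fP] i(2) by (simp add: v_def)
      moreover have "d (\<pi>' f z) (\<pi> f z) \<le> d (\<pi>' f z) (y (f, i)) + d (y (f, i)) (\<pi> f z)"
        using triangle Rep_in[OF \<pi>' fG] Rep_in[OF \<pi> fG] ptM[OF i(1)] yM[rule_format, OF fZ] i(2) by simp
      ultimately show ?thesis using \<eta> unfolding \<delta>_def by linarith
    qed
    then have "\<pi>' \<in> V" using nbhd \<pi>' by blast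
    moreover have "\<bar>d (\<pi>' \<gamma> x) x - c\<bar> < \<epsilon>" if \<gamma>: "\<gamma> \<in> carrier \<Gamma> - E" for \<gamma>
    proof -
      let ?y = "y (\<one>, 0)"
      have \<gamma>G: "\<gamma> \<in> carrier \<Gamma>" using \<gamma> by blast
      have y: "?y \<in> M" "d ?y x \<le> \<eta>" using base(3,4)[OF k] pt0 by auto
      have "d ?y (\<pi>' \<gamma> ?y) = c"
        using y_orbit[OF \<gamma>G k] y_dist[rule_format, OF base(2)[OF k], of "(\<gamma>, 0)"] \<sigma>(5) \<gamma> k by simp
      moreover have "d (\<pi>' \<gamma> ?y) (\<pi>' \<gamma> x) = d ?y x" by (rule Rep_isometric[OF \<pi>' \<gamma>G y(1) x])
      moreover have "\<pi>' \<gamma> ?y \<in> M" "\<pi>' \<gamma> x \<in> M" using Rep_in[OF \<pi>' \<gamma>G] y(1) x by auto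
      ultimately have "\<bar>d (\<pi>' \<gamma> x) x - c\<bar> \<le> 2 * \<eta>"
        using y x triangle[of ?y x "\<pi>' \<gamma> ?y"] triangle[of x "\<pi>' \<gamma> x" "\<pi>' \<gamma> ?y"]
          triangle[of "\<pi>' \<gamma> x" "\<pi>' \<gamma> ?y" x] triangle[of "\<pi>' \<gamma> ?y" ?y x]
          commute[of "\<pi>' \<gamma> x" x] commute[of "\<pi>' \<gamma> x" "\<pi>' \<gamma> ?y"] commute[of ?y "\<pi>' \<gamma> ?y"]
        by linarith
      then show ?thesis using \<eta> unfolding \<delta>_def by linarith
    qed
    ultimately show "\<exists>E. finite E \<and> (\<forall>\<gamma>\<in>carrier \<Gamma> - E. \<exists>\<pi>'\<in>V. \<bar>d (\<pi>' \<gamma> x) x - c\<bar> < \<epsilon>)"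
      using E by blast
  qed
qed

end

section \<open>Conjugacy classes are meager\<close>

context rational_completion
begin

lemma displacement_Lipschitz:
  assumes "\<pi> \<in> Rep \<Gamma> M d" "\<gamma> \<in> carrier \<Gamma>" "x \<in> M" "y \<in> M"
  shows "d (\<pi> \<gamma> y) y \<le> d (\<pi> \<gamma> x) x + 2 * d x y"
  using Rep_isometric[OF assms] Rep_in[OF assms(1-3)] Rep_in[OF assms(1,2,4)] assms(3,4)
    triangle[of "\<pi> \<gamma> y" "\<pi> \<gamma> x" y] triangle[of "\<pi> \<gamma> x" x y] commute[of "\<pi> \<gamma> x" "\<pi> \<gamma> y"]
  by linarith

text \<open>If \<open>\<pi>\<close> is the conjugate of \<open>\<pi>0\<close> by \<open>g\<close>, then \<open>\<pi> \<gamma> (g y) = g (\<pi>0 \<gamma> y)\<close>, and \<open>g\<close> is isometric.\<close>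

lemma conjugacy_class_displacement:
  assumes "group \<Gamma>" "C \<in> conjugacy_classes \<Gamma> M d"
  shows "\<exists>\<pi>0\<in>Rep \<Gamma> M d. \<forall>\<pi>\<in>C. \<pi> \<in> Rep \<Gamma> M d \<and>
    (\<exists>g. g ` M = M \<and> (\<forall>\<gamma>\<in>carrier \<Gamma>. \<forall>y\<in>M. d (\<pi> \<gamma> (g y)) (g y) = d (\<pi>0 \<gamma> y) y))"
proof -
  interpret I: group "Iso M d" by (rule group_Iso)
  obtain \<pi>0 where \<pi>0: "\<pi>0 \<in> Rep \<Gamma> M d" "C = orbit (Iso M d) (conj_action \<Gamma> M d) \<pi>0"
    using assms(2) by (auto simp: conjugacy_classes_def orbits_def)
  have "\<pi> \<in> Rep \<Gamma> M d \<and>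
      (\<exists>g. g ` M = M \<and> (\<forall>\<gamma>\<in>carrier \<Gamma>. \<forall>y\<in>M. d (\<pi> \<gamma> (g y)) (g y) = d (\<pi>0 \<gamma> y) y))" if \<pi>C: "\<pi> \<in> C" for \<pi>
  proof -
    obtain g where g: "g \<in> carrier (Iso M d)" "\<pi> = conj_action \<Gamma> M d g \<pi>0"
      using \<pi>C \<pi>0(2) by (auto simp: orbit_def)
    have \<pi>: "\<pi> \<in> Rep \<Gamma> M d" using conj_action_closed[OF assms(1) g(1) \<pi>0(1)] g(2) by simp
    have gM: "g ` M = M" and g_iso: "isometric_on M d d g" using g(1) by (auto simp: Iso_def Bij_def bij_betw_def)
    have "d (\<pi> \<gamma> (g y)) (g y) = d (\<pi>0 \<gamma> y) y" if \<gamma>: "\<gamma> \<in> carrier \<Gamma>" and y: "y \<in> M" for \<gamma> y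
    proof -
      have c: "\<pi>0 \<gamma> \<in> carrier (Iso M d)" "\<pi> \<gamma> \<in> carrier (Iso M d)"
        using \<pi>0(1) \<pi> \<gamma> by (auto simp: Rep_def hom_def)
      have "\<pi> \<gamma> = g \<otimes>\<^bsub>Iso M d\<^esub> \<pi>0 \<gamma> \<otimes>\<^bsub>Iso M d\<^esub> inv\<^bsub>Iso M d\<^esub> g"
        using g(2) \<pi>0(1) \<gamma> by (simp add: conj_action_def)
      then have "\<pi> \<gamma> \<otimes>\<^bsub>Iso M d\<^esub> g = g \<otimes>\<^bsub>Iso M d\<^esub> \<pi>0 \<gamma>"
        using g(1) c by (simp add: I.m_assoc)
      moreover have "g \<in> Bij M" "\<pi> \<gamma> \<in> Bij M" "\<pi>0 \<gamma> \<in> Bij M" using g(1) c by (auto simp: Iso_def)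
      ultimately have "compose M (\<pi> \<gamma>) g = compose M g (\<pi>0 \<gamma>)" by (simp add: Iso_def BijGroup_def)
      then have "\<pi> \<gamma> (g y) = g (\<pi>0 \<gamma> y)" using y by (metis compose_eq)
      moreover have "d (g (\<pi>0 \<gamma> y)) (g y) = d (\<pi>0 \<gamma> y) y"
        using g_iso Rep_in[OF \<pi>0(1) \<gamma> y] y by (simp add: isometric_on_def)
      ultimately show ?thesis by simp
    qed
    then show ?thesis using \<pi> gM by blast
  qed
  then show ?thesis using \<pi>0(1) by blast
qed

lemma finite_diameter_bound:
  assumes "finite P"
  shows "\<exists>m :: nat. 0 < m \<and> K \<le> real m \<and> (\<forall>y\<in>P. \<forall>z\<in>P. d y z \<le> real m)"
proof -
  obtain m where m: "Max (insert K (insert 1 ((\<lambda>(y, z). d y z) ` (P \<times> P)))) \<le> real m"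
    using real_arch_simple by blast
  have "finite (insert K (insert 1 ((\<lambda>(y, z). d y z) ` (P \<times> P))))" using assms by simp
  from Max_ge[OF this] m have le: "r \<le> real m" if "r \<in> insert K (insert 1 ((\<lambda>(y, z). d y z) ` (P \<times> P)))" for r
    using that by (meson order_trans)
  have "1 \<le> real m" "K \<le> real m" using le[of 1] le[of K] by simp_all
  moreover have "d y z \<le> real m" if "y \<in> P" "z \<in> P" for y z
  proof -
    have "(\<lambda>(y, z). d y z) (y, z) \<in> (\<lambda>(y, z). d y z) ` (P \<times> P)" using that by (intro imageI) simp
    then show ?thesis using le[of "d y z"] by simp
  qed
  ultimately show ?thesis by (intro exI[of _ m]) auto
qed

lemma nonempty_M: "M \<noteq> {}"
proof -
  have "\<exists>z\<in>Q. \<forall>a\<in>{}. d z a = (undefined :: 'a \<Rightarrow> real) a"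
    by (intro extensions_Q[unfolded has_extensions_def, rule_format]) (simp add: Katetov_over_def)
  then show ?thesis using Q_in by blast
qed

lemma meager_conjugacy_class_unbounded:
  assumes grp: "group \<Gamma>" and cnt: "countable (carrier \<Gamma>)" and inf: "infinite (carrier \<Gamma>)"
    and D: "\<And>n :: nat. real n \<in> D" and C: "C \<in> conjugacy_classes \<Gamma> M d"
  shows "meager_in (Rep_topology \<Gamma> M d) C"
proof -
  have MS: "Metric_space M d" by unfold_locales
  obtain x where x: "x \<in> M" using nonempty_M by blast
  obtain \<pi>0 where \<pi>0: "\<pi>0 \<in> Rep \<Gamma> M d" and C_disp: "\<forall>\<pi>\<in>C. \<pi> \<in> Rep \<Gamma> M d \<and>
    (\<exists>g. g ` M = M \<and> (\<forall>\<gamma>\<in>carrier \<Gamma>. \<forall>y\<in>M. d (\<pi> \<gamma> (g y)) (g y) = d (\<pi>0 \<gamma> y) y))"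
    using conjugacy_class_displacement[OF grp C] by (elim bexE)
  define \<tau> where "\<tau> \<gamma> = d (\<pi>0 \<gamma> x) x" for \<gamma>
  have close: "\<exists>n :: nat. \<forall>\<gamma>\<in>carrier \<Gamma>. \<bar>d (\<pi> \<gamma> x) x - \<tau> \<gamma>\<bar> \<le> real n" if \<pi>: "\<pi> \<in> C" for \<pi>
  proof -
    obtain g where g: "g ` M = M" "\<forall>\<gamma>\<in>carrier \<Gamma>. \<forall>y\<in>M. d (\<pi> \<gamma> (g y)) (g y) = d (\<pi>0 \<gamma> y) y"
      using C_disp \<pi> by blast
    have "x \<in> g ` M" using g(1) x by simp
    then obtain y where y: "y \<in> M" "g y = x" by blast
    obtain n where n: "2 * d x y \<le> real n" using real_arch_simple by blast
    have "\<bar>d (\<pi> \<gamma> x) x - \<tau> \<gamma>\<bar> \<le> real n" if \<gamma>: "\<gamma> \<in> carrier \<Gamma>" for \<gamma>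
    proof -
      have "d (\<pi> \<gamma> x) x = d (\<pi>0 \<gamma> y) y" using g(2)[rule_format, OF \<gamma> y(1)] y(2) by simp
      then show ?thesis
        using displacement_Lipschitz[OF \<pi>0 \<gamma> x y(1)] displacement_Lipschitz[OF \<pi>0 \<gamma> y(1) x] n commute[of x y]
        by (simp add: \<tau>_def)
    qed
    then show ?thesis by blast
  qed
  have perturb: "\<exists>m E. real m \<ge> K \<and> finite E \<and> (\<forall>\<gamma>\<in>carrier \<Gamma> - E. \<exists>\<pi>'\<in>V. \<bar>d (\<pi>' \<gamma> x) x - real m\<bar> < 1)"
    if V: "openin (Rep_topology \<Gamma> M d) V" "\<pi> \<in> V" for V \<pi> K
  proof -
    obtain P where P: "finite P" "\<forall>m :: nat. 0 < m \<longrightarrow> real m \<in> D \<longrightarrow> (\<forall>y\<in>P. \<forall>z\<in>P. d y z \<le> m) \<longrightarrow>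
      (\<forall>c \<epsilon> :: real. (c = real m \<or> c = real m / 2) \<longrightarrow> 0 < \<epsilon> \<longrightarrow>
        (\<exists>E. finite E \<and> (\<forall>\<gamma>\<in>carrier \<Gamma> - E. \<exists>\<pi>'\<in>V. \<bar>d (\<pi>' \<gamma> x) x - c\<bar> < \<epsilon>)))"
      using displacement_dense[OF grp cnt V x] by (elim exE conjE)
    obtain m :: nat where m: "0 < m" "K \<le> real m" "\<forall>y\<in>P. \<forall>z\<in>P. d y z \<le> real m"
      using finite_diameter_bound[OF P(1), of K] by (elim exE conjE)
    have "\<exists>E. finite E \<and> (\<forall>\<gamma>\<in>carrier \<Gamma> - E. \<exists>\<pi>'\<in>V. \<bar>d (\<pi>' \<gamma> x) x - real m\<bar> < 1)"
      by (rule P(2)[rule_format, OF m(1) D]) (use m(3) in auto)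
    then show ?thesis using m(2) by blast
  qed
  show ?thesis
  proof (cases "\<exists>R. infinite {\<gamma> \<in> carrier \<Gamma>. \<tau> \<gamma> \<le> R}")
    case True
    then obtain R where R: "infinite {\<gamma> \<in> carrier \<Gamma>. \<tau> \<gamma> \<le> R}" ..
    define A where "A = {\<gamma> \<in> carrier \<Gamma>. \<tau> \<gamma> \<le> R}"
    show ?thesis
    proof (rule meager_in_countable_cover)
      show "countable (UNIV :: nat set)" by simp
      show "nowhere_dense_in (Rep_topology \<Gamma> M d) {\<pi> \<in> Rep \<Gamma> M d. \<forall>\<gamma>\<in>A. d (\<pi> \<gamma> x) x \<notin> {real n <..}}" for n :: nat
      proof (rule nowhere_dense_displacement[OF MS _ x])
        fix V \<pi> assume "openin (Rep_topology \<Gamma> M d) V" "\<pi> \<in> V"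
        from perturb[OF this, of "real n + 1"] obtain m E where mE: "real n + 1 \<le> real m" "finite E"
          "\<forall>\<gamma>\<in>carrier \<Gamma> - E. \<exists>\<pi>'\<in>V. \<bar>d (\<pi>' \<gamma> x) x - real m\<bar> < 1" by (elim exE conjE)
        obtain \<gamma> where \<gamma>: "\<gamma> \<in> A - E"
          using Diff_infinite_finite[OF mE(2) R] unfolding A_def by (metis ex_in_conv finite.emptyI)
        then obtain \<pi>' where \<pi>': "\<pi>' \<in> V" "\<bar>d (\<pi>' \<gamma> x) x - real m\<bar> < 1" using mE(3) by (auto simp: A_def)
        have "real n < d (\<pi>' \<gamma> x) x" using \<pi>'(2) mE(1) by (auto simp: abs_if split: if_splits)
        then show "\<exists>\<gamma>\<in>A. \<exists>\<pi>'\<in>V. d (\<pi>' \<gamma> x) x \<in> {real n <..}"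
          using \<gamma> \<pi>'(1) by (intro bexI[of _ \<gamma>] bexI[of _ \<pi>']) auto
      qed (auto simp: A_def)
      show "C \<subseteq> (\<Union>n. {\<pi> \<in> Rep \<Gamma> M d. \<forall>\<gamma>\<in>A. d (\<pi> \<gamma> x) x \<notin> {real n <..}})"
      proof
        fix \<pi> assume \<pi>: "\<pi> \<in> C"
        obtain n where n: "\<forall>\<gamma>\<in>carrier \<Gamma>. \<bar>d (\<pi> \<gamma> x) x - \<tau> \<gamma>\<bar> \<le> real n" using close[OF \<pi>] ..
        obtain k where k: "R + real n \<le> real k" using real_arch_simple by blast
        have "d (\<pi> \<gamma> x) x \<le> real k" if "\<gamma> \<in> A" for \<gamma>
        proof -
          have "\<bar>d (\<pi> \<gamma> x) x - \<tau> \<gamma>\<bar> \<le> real n" "\<tau> \<gamma> \<le> R" using that n by (auto simp: A_def)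
          then show ?thesis using k by linarith
        qed
        then show "\<pi> \<in> (\<Union>n. {\<pi> \<in> Rep \<Gamma> M d. \<forall>\<gamma>\<in>A. d (\<pi> \<gamma> x) x \<notin> {real n <..}})"
          using C_disp \<pi> by (intro UN_I[of k]) (auto simp: not_less)
      qed
    qed
  next
    case False
    then have fin: "finite {\<gamma> \<in> carrier \<Gamma>. \<tau> \<gamma> \<le> R}" for R by blast
    show ?thesis
    proof (rule meager_in_countable_cover)
      show "countable (UNIV :: nat set)" by simp
      show "nowhere_dense_in (Rep_topology \<Gamma> M d)
        {\<pi> \<in> Rep \<Gamma> M d. \<forall>\<gamma>\<in>carrier \<Gamma>. d (\<pi> \<gamma> x) x \<notin> {..< \<tau> \<gamma> - real n}}" for n :: nat
      proof (rule nowhere_dense_displacement[OF MS order_refl x])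
        fix V \<pi> assume "openin (Rep_topology \<Gamma> M d) V" "\<pi> \<in> V"
        from perturb[OF this, of 0] obtain m E where mE: "finite E"
          "\<forall>\<gamma>\<in>carrier \<Gamma> - E. \<exists>\<pi>'\<in>V. \<bar>d (\<pi>' \<gamma> x) x - real m\<bar> < 1" by (elim exE conjE)
        \<comment> \<open>Now that \<open>V\<close> has determined \<open>m\<close>, take \<open>\<gamma>\<close> where \<open>\<pi>0\<close> displaces \<open>x\<close> by much more than \<open>m\<close>.\<close>
        have "infinite (carrier \<Gamma> - (E \<union> {\<gamma> \<in> carrier \<Gamma>. \<tau> \<gamma> \<le> real m + 1 + real n}))"
          using mE(1) fin inf by (intro Diff_infinite_finite) auto
        then obtain \<gamma> where \<gamma>: "\<gamma> \<in> carrier \<Gamma> - (E \<union> {\<gamma> \<in> carrier \<Gamma>. \<tau> \<gamma> \<le> real m + 1 + real n})"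
          by (metis ex_in_conv finite.emptyI)
        then obtain \<pi>' where \<pi>': "\<pi>' \<in> V" "\<bar>d (\<pi>' \<gamma> x) x - real m\<bar> < 1" using mE(2) by blast
        have "d (\<pi>' \<gamma> x) x < \<tau> \<gamma> - real n" using \<pi>'(2) \<gamma> by (auto simp: abs_if split: if_splits)
        then show "\<exists>\<gamma>\<in>carrier \<Gamma>. \<exists>\<pi>'\<in>V. d (\<pi>' \<gamma> x) x \<in> {..< \<tau> \<gamma> - real n}"
          using \<gamma> \<pi>'(1) by (intro bexI[of _ \<gamma>] bexI[of _ \<pi>']) auto
      qed auto
      show "C \<subseteq> (\<Union>n. {\<pi> \<in> Rep \<Gamma> M d. \<forall>\<gamma>\<in>carrier \<Gamma>. d (\<pi> \<gamma> x) x \<notin> {..< \<tau> \<gamma> - real n}})"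
      proof
        fix \<pi> assume \<pi>: "\<pi> \<in> C"
        obtain n where n: "\<forall>\<gamma>\<in>carrier \<Gamma>. \<bar>d (\<pi> \<gamma> x) x - \<tau> \<gamma>\<bar> \<le> real n" using close[OF \<pi>] ..
        have "\<tau> \<gamma> - real n \<le> d (\<pi> \<gamma> x) x" if "\<gamma> \<in> carrier \<Gamma>" for \<gamma>
          using n[rule_format, OF that] by linarith
        then show "\<pi> \<in> (\<Union>n. {\<pi> \<in> Rep \<Gamma> M d. \<forall>\<gamma>\<in>carrier \<Gamma>. d (\<pi> \<gamma> x) x \<notin> {..< \<tau> \<gamma> - real n}})"
          using C_disp \<pi> by (intro UN_I[of n]) (auto simp: not_less)
      qed
    qed
  qed
qed

lemma meager_conjugacy_class_bounded:
  assumes grp: "group \<Gamma>" and cnt: "countable (carrier \<Gamma>)" and inf: "infinite (carrier \<Gamma>)"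
    and D: "D \<subseteq> {..1}" and C: "C \<in> conjugacy_classes \<Gamma> M d"
  shows "meager_in (Rep_topology \<Gamma> M d) C"
proof -
  have MS: "Metric_space M d" by unfold_locales
  have d_le: "d y z \<le> 1" if yz: "y \<in> M" "z \<in> M" for y z
  proof (rule field_le_epsilon)
    fix e :: real assume "0 < e"
    then have e: "0 < e / 2" by simp
    obtain p q where pq: "p \<in> Q" "q \<in> Q" "d y p < e / 2" "d z q < e / 2"
      using dense[OF yz(1) e] dense[OF yz(2) e] by blast
    have "d p q \<le> 1" using metric_overD(1)[OF metric_Q pq(1,2)] D by auto
    then show "d y z \<le> 1 + e"
      using pq triangle[of y p z] triangle[of p q z] Q_in[OF pq(1)] Q_in[OF pq(2)] yz commute[of z q]
      by linarith
  qed
  have one: "real 1 \<in> D" using scale by (simp add: distance_scale_def)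
  have perturb: "\<exists>E. finite E \<and> (\<forall>\<gamma>\<in>carrier \<Gamma> - E. \<exists>\<pi>'\<in>V. \<bar>d (\<pi>' \<gamma> x) x - c\<bar> < 1 / 8)"
    if V: "openin (Rep_topology \<Gamma> M d) V" "\<pi> \<in> V" and x: "x \<in> M" and c: "c = 1 \<or> c = 1 / 2" for V \<pi> x c
  proof -
    obtain P where P: "P \<subseteq> M" "\<forall>m :: nat. 0 < m \<longrightarrow> real m \<in> D \<longrightarrow> (\<forall>y\<in>P. \<forall>z\<in>P. d y z \<le> m) \<longrightarrow>
      (\<forall>c \<epsilon> :: real. (c = real m \<or> c = real m / 2) \<longrightarrow> 0 < \<epsilon> \<longrightarrow>
        (\<exists>E. finite E \<and> (\<forall>\<gamma>\<in>carrier \<Gamma> - E. \<exists>\<pi>'\<in>V. \<bar>d (\<pi>' \<gamma> x) x - c\<bar> < \<epsilon>)))"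
      using displacement_dense[OF grp cnt V x] by (elim exE conjE)
    have "d y z \<le> real 1" if "y \<in> P" "z \<in> P" for y z using d_le[of y z] P(1) that by auto
    then show ?thesis using c by (intro P(2)[rule_format, OF _ one]) auto
  qed
  obtain \<pi>0 where \<pi>0: "\<pi>0 \<in> Rep \<Gamma> M d" and C_disp: "\<forall>\<pi>\<in>C. \<pi> \<in> Rep \<Gamma> M d \<and>
    (\<exists>g. g ` M = M \<and> (\<forall>\<gamma>\<in>carrier \<Gamma>. \<forall>y\<in>M. d (\<pi> \<gamma> (g y)) (g y) = d (\<pi>0 \<gamma> y) y))"
    using conjugacy_class_displacement[OF grp C] by (elim bexE)
  show ?thesis
  proof (cases "\<exists>y\<in>M. infinite {\<gamma> \<in> carrier \<Gamma>. 3 / 4 < d (\<pi>0 \<gamma> y) y}")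
    case True
    then obtain y where y: "y \<in> M" and inf_A: "infinite {\<gamma> \<in> carrier \<Gamma>. 3 / 4 < d (\<pi>0 \<gamma> y) y}" ..
    define A where "A = {\<gamma> \<in> carrier \<Gamma>. 3 / 4 < d (\<pi>0 \<gamma> y) y}"
    show ?thesis
    proof (rule meager_in_countable_cover[OF countable_Q])
      fix q assume q: "q \<in> Q"
      show "nowhere_dense_in (Rep_topology \<Gamma> M d) {\<pi> \<in> Rep \<Gamma> M d. \<forall>\<gamma>\<in>A. d (\<pi> \<gamma> q) q \<notin> {..<5/8}}"
      proof (rule nowhere_dense_displacement[OF MS _ Q_in[OF q]])
        fix V \<pi> assume "openin (Rep_topology \<Gamma> M d) V" "\<pi> \<in> V"
        from perturb[OF this Q_in[OF q], of "1 / 2"] obtain E where E: "finite E"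
          "\<forall>\<gamma>\<in>carrier \<Gamma> - E. \<exists>\<pi>'\<in>V. \<bar>d (\<pi>' \<gamma> q) q - 1 / 2\<bar> < 1 / 8" by auto
        obtain \<gamma> where \<gamma>: "\<gamma> \<in> A - E"
          using Diff_infinite_finite[OF E(1) inf_A] unfolding A_def by (metis ex_in_conv finite.emptyI)
        then obtain \<pi>' where \<pi>': "\<pi>' \<in> V" "\<bar>d (\<pi>' \<gamma> q) q - 1 / 2\<bar> < 1 / 8" using E(2) by (auto simp: A_def)
        have "d (\<pi>' \<gamma> q) q < 5 / 8" using \<pi>'(2) by (auto simp: abs_if split: if_splits)
        then show "\<exists>\<gamma>\<in>A. \<exists>\<pi>'\<in>V. d (\<pi>' \<gamma> q) q \<in> {..<5/8}"
          using \<gamma> \<pi>'(1) by (intro bexI[of _ \<gamma>] bexI[of _ \<pi>']) auto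
      qed (auto simp: A_def)
    next
      show "C \<subseteq> (\<Union>q\<in>Q. {\<pi> \<in> Rep \<Gamma> M d. \<forall>\<gamma>\<in>A. d (\<pi> \<gamma> q) q \<notin> {..<5/8}})"
      proof
        fix \<pi> assume "\<pi> \<in> C"
        then have \<pi>: "\<pi> \<in> Rep \<Gamma> M d" using C_disp by blast
        obtain g where g: "g ` M = M" "\<forall>\<gamma>\<in>carrier \<Gamma>. \<forall>y\<in>M. d (\<pi> \<gamma> (g y)) (g y) = d (\<pi>0 \<gamma> y) y"
          using C_disp \<open>\<pi> \<in> C\<close> by blast
        have gy: "g y \<in> M" using g(1) y by blast
        obtain q where q: "q \<in> Q" "d (g y) q < 1 / 16" using dense[OF gy, of "1 / 16"] by auto
        have "5 / 8 \<le> d (\<pi> \<gamma> q) q" if "\<gamma> \<in> A" for \<gamma>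
        proof -
          have \<gamma>: "\<gamma> \<in> carrier \<Gamma>" "3 / 4 < d (\<pi>0 \<gamma> y) y" using that by (auto simp: A_def)
          show ?thesis
            using displacement_Lipschitz[OF \<pi> \<gamma>(1) Q_in[OF q(1)] gy] \<gamma>(2) q(2) g(2)[rule_format, OF \<gamma>(1) y]
              commute[of q "g y"] by linarith
        qed
        then show "\<pi> \<in> (\<Union>q\<in>Q. {\<pi> \<in> Rep \<Gamma> M d. \<forall>\<gamma>\<in>A. d (\<pi> \<gamma> q) q \<notin> {..<5/8}})"
          using \<pi> q(1) by (intro UN_I[of q]) (auto simp: not_less)
      qed
    qed
  next
    case False
    then have fin: "finite {\<gamma> \<in> carrier \<Gamma>. 3 / 4 < d (\<pi>0 \<gamma> y) y}" if "y \<in> M" for y using that by blast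
    obtain x where x: "x \<in> M" using nonempty_M by blast
    show ?thesis
    proof (rule meager_in_countable_cover)
      show "countable {F. F \<subseteq> carrier \<Gamma> \<and> finite F}"
        using countable_Collect_finite_subset[OF cnt] by (simp add: conj_commute)
      fix F assume F: "F \<in> {F. F \<subseteq> carrier \<Gamma> \<and> finite F}"
      show "nowhere_dense_in (Rep_topology \<Gamma> M d)
        {\<pi> \<in> Rep \<Gamma> M d. \<forall>\<gamma>\<in>carrier \<Gamma> - F. d (\<pi> \<gamma> x) x \<notin> {3/4<..}}"
      proof (rule nowhere_dense_displacement[OF MS Diff_subset x])
        fix V \<pi> assume "openin (Rep_topology \<Gamma> M d) V" "\<pi> \<in> V"
        from perturb[OF this x, of 1] obtain E where E: "finite E"
          "\<forall>\<gamma>\<in>carrier \<Gamma> - E. \<exists>\<pi>'\<in>V. \<bar>d (\<pi>' \<gamma> x) x - 1\<bar> < 1 / 8" by auto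
        have "infinite (carrier \<Gamma> - (E \<union> F))" using E(1) F inf by (intro Diff_infinite_finite) auto
        then obtain \<gamma> where \<gamma>: "\<gamma> \<in> carrier \<Gamma> - (E \<union> F)" by (metis ex_in_conv finite.emptyI)
        then obtain \<pi>' where \<pi>': "\<pi>' \<in> V" "\<bar>d (\<pi>' \<gamma> x) x - 1\<bar> < 1 / 8" using E(2) by blast
        have "3 / 4 < d (\<pi>' \<gamma> x) x" using \<pi>'(2) by (auto simp: abs_if split: if_splits)
        then show "\<exists>\<gamma>\<in>carrier \<Gamma> - F. \<exists>\<pi>'\<in>V. d (\<pi>' \<gamma> x) x \<in> {3/4<..}"
          using \<gamma> \<pi>'(1) by (intro bexI[of _ \<gamma>] bexI[of _ \<pi>']) auto
      qed auto
    next
      show "C \<subseteq> (\<Union>F\<in>{F. F \<subseteq> carrier \<Gamma> \<and> finite F}.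
        {\<pi> \<in> Rep \<Gamma> M d. \<forall>\<gamma>\<in>carrier \<Gamma> - F. d (\<pi> \<gamma> x) x \<notin> {3/4<..}})"
      proof
        fix \<pi> assume \<pi>: "\<pi> \<in> C"
        obtain g where g: "g ` M = M" "\<forall>\<gamma>\<in>carrier \<Gamma>. \<forall>y\<in>M. d (\<pi> \<gamma> (g y)) (g y) = d (\<pi>0 \<gamma> y) y"
          using C_disp \<pi> by blast
        have "x \<in> g ` M" using g(1) x by simp
        then obtain y where y: "y \<in> M" "g y = x" by blast
        have disp: "d (\<pi> \<gamma> x) x = d (\<pi>0 \<gamma> y) y" if "\<gamma> \<in> carrier \<Gamma>" for \<gamma>
          using g(2)[rule_format, OF that y(1)] y(2) by simp
        show "\<pi> \<in> (\<Union>F\<in>{F. F \<subseteq> carrier \<Gamma> \<and> finite F}.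
          {\<pi> \<in> Rep \<Gamma> M d. \<forall>\<gamma>\<in>carrier \<Gamma> - F. d (\<pi> \<gamma> x) x \<notin> {3/4<..}})"
          using fin[OF y(1)] C_disp \<pi> disp
          by (intro UN_I[of "{\<gamma> \<in> carrier \<Gamma>. 3 / 4 < d (\<pi>0 \<gamma> y) y}"]) auto
      qed
    qed
  qed
qed

end

lemma rational_completion_Fraisse:
  assumes D: "distance_scale D" "0 \<in> D" and F: "Fraisse_limit_over D Q d" and c: "is_completion_of M d Q"
  shows "rational_completion M d Q D"
proof -
  interpret Metric_space M d using c by (simp add: is_completion_of_def)
  show ?thesis
  proof
    show "countable Q" using F by (simp add: Fraisse_limit_over_def)
  qed (use assms Fraisse_limit_metric_over Fraisse_limit_has_extensions in blast)+
qed

theorem theorem3p7: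
  fixes \<Gamma> :: "('g, 'b) monoid_scheme"
    and U :: "'u set" and d :: "'u \<Rightarrow> 'u \<Rightarrow> real"
    and U1 :: "'v set" and d1 :: "'v \<Rightarrow> 'v \<Rightarrow> real"
  assumes "group \<Gamma>" and "countable (carrier \<Gamma>)" and "infinite (carrier \<Gamma>)"
  shows "(Urysohn_space U d \<longrightarrow>
            (\<forall>C \<in> conjugacy_classes \<Gamma> U d. meager_in (Rep_topology \<Gamma> U d) C)) \<and>
         (Urysohn_sphere U1 d1 \<longrightarrow>
            (\<forall>C \<in> conjugacy_classes \<Gamma> U1 d1. meager_in (Rep_topology \<Gamma> U1 d1) C))"
proof (intro conjI impI ballI)
  fix C assume "Urysohn_space U d" and C: "C \<in> conjugacy_classes \<Gamma> U d"
  then obtain Q where Q: "Fraisse_limit_over \<rat> Q d" "is_completion_of U d Q"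
    by (auto simp: Urysohn_space_def)
  have "distance_scale \<rat>" by (simp add: distance_scale_def)
  then interpret rational_completion U d Q \<rat> using Q by (intro rational_completion_Fraisse) auto
  show "meager_in (Rep_topology \<Gamma> U d) C"
    by (rule meager_conjugacy_class_unbounded[OF assms _ C]) simp
next
  fix C assume "Urysohn_sphere U1 d1" and C: "C \<in> conjugacy_classes \<Gamma> U1 d1"
  then obtain Q where Q: "Fraisse_limit_over (\<rat> \<inter> {0..1}) Q d1" "is_completion_of U1 d1 Q"
    by (auto simp: Urysohn_sphere_def)
  have "distance_scale (\<rat> \<inter> {0..1})" by (auto simp: distance_scale_def)
  then interpret rational_completion U1 d1 Q "\<rat> \<inter> {0..1}" using Q by (intro rational_completion_Fraisse) auto
  show "meager_in (Rep_topology \<Gamma> U1 d1) C"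
    by (rule meager_conjugacy_class_bounded[OF assms _ C]) auto
qed

end
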